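(* Let $\nu\in\mathcal V_x$ and let $\{Q_i\}_{i\in I(\nu)}$, $\Psi_i(\nu)$ be as produced by the construction described in the context. Suppose that the construction does not stop, so that $I(\nu)=\mathbb N=\{1,2,\dots\}$, and that the set $\Psi_i(\nu)$ is finite for each $i\in I(\nu)$. Then $\{Q_i\}_{i\in I(\nu)}$ is a complete set of key polynomials for $\nu$.
   Context: Let $k$ be a field, $K=k(x)$, and let $y$ be an independent variable. $\mathcal V_x$ denotes the set of valuations of $k(x,y)$ that are normalized, proper, centered at $k[x,y]_{(x,y)}$ and satisfy $\nu(x)=1$; concretely, the set of maps $\nu:K[y]\to\mathbb R\cup\{\infty\}$ with $\nu(f+g)\ge\min(\nu(f),\nu(g))$, $\nu(fg)=\nu(f)+\nu(g)$, $\nu(0)=\infty$, whose restriction to $K$ is the $x$-adic valuation (trivial on $k$, $\nu(x)=1$) and such that $\nu(y)\ge1$. Nonzero polynomials may have value $\infty$. Order: $\mu\le\nu$ iff $\mu(f)\le\nu(f)$ for all $f\in K[y]$. The augmented value group $\Gamma_\nu\subset\mathbb R\cup\{\infty\}$ is the set of values of $\nu$ (including $\infty$), $\nu$ being extended to fractions with denominators of finite value. Truncation: for a monic $Q\in K[y]$ and $g\in K[y]$ write the $Q$-expansion $g=\sum_{j=0}^s g_jQ^j$ with $\deg_y g_j<\deg_y Q$, and put $\nu_Q(g)=\min_j\nu(g_jQ^j)$. Key polynomials: $\partial_b=\frac{1}{b!}\frac{\partial^b}{\partial y^b}$ ($b\ge1$) is the $b$-th formal (Hasse) derivative with respect to $y$;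 for nonzero $P\in K[y]$ put $\epsilon_\nu(P)=\max_{b\ge1}\frac{\nu(P)-\nu(\partial_bP)}{b}$ (terms with $\nu(\partial_bP)=\infty$ are counted as $-\infty$). A monic $Q\in K[y]$ with $\nu(Q)\ge\nu(y)$ is a key polynomial for $\nu$ if every polynomial $f$ with $\epsilon_\nu(f)\ge\epsilon_\nu(Q)$ satisfies $\deg_y f\ge\deg_y Q$. Complete set: a set $\{Q_i\}_{i\in I}$ of key polynomials for $\nu$, indexed by a well ordered set $I$, is complete for $\nu$ if for each $\beta\in\Gamma_\nu$ the additive group $\{f\in K[y]\mid\nu(f)\ge\beta\}$ is generated by products $a\prod_{j=1}^sQ_{i_j}^{\gamma_j}$ with $a\in K$, $\gamma_j\in\mathbb Z_{\ge0}$ and $\nu(a)+\sum_{j=1}^s\gamma_j\nu(Q_{i_j})\ge\beta$. Construction: $Q_1=y$, $d_1(\nu)=1$, $\beta_1(\nu)=\nu(y)$, $\nu_1=\nu_{Q_1}$. Suppose $Q_n$ and $\nu_n=\nu_{Q_n}$ are constructed. If $\nu_n=\nu$, stop and put $I(\nu)=\{1,\dots,n\}$. Otherwise $\nu_n<\nu$; let $d_{n+1}(\nu)$ be the minimal degree of a monic $f\in K[y]$ with $\nu_n(f)<\nu(f)$, let $\Phi_n(\nu)$ be the set of monic $Q\in K[y]$ with $\deg_yQ=d_{n+1}(\nu)$ and $\nu_n(Q)<\nu(Q)$, let $\Psi_n(\nu)=\nu(\Phi_n(\nu))$ (a set that has a smallest element), let $\beta_{n+1}(\nu)=\min\Psi_n(\nu)$,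 choose $Q_{n+1}\in\Phi_n(\nu)$ with $\nu(Q_{n+1})=\beta_{n+1}(\nu)$ and put $\nu_{n+1}=\nu_{Q_{n+1}}$ (a valuation with $\nu_n<\nu_{n+1}\le\nu$). If the process never stops, $I(\nu)=\mathbb N$. *)

theory Defs
  imports
    "HOL-Library.Extended_Real"
    "HOL-Computational_Algebra.Polynomial"
    "HOL-Computational_Algebra.Fraction_Field"
    "HOL-Computational_Algebra.Group_Closure"
begin

text \<open>
  The field \<open>K = k(x)\<close> is \<open>'k poly fract\<close> and \<open>K[y]\<close> is \<open>'k poly fract poly\<close>. Values in
  \<open>\<real> \<union> {\<infinity>}\<close> are extended reals different from \<open>-\<infinity>\<close>. A constant \<open>a \<in> K\<close>, seen in \<open>K[y]\<close>,
  is \<open>[:a:]\<close>.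
\<close>

type_synonym 'k Ky = "'k poly fract poly"

subsection \<open>The valuations\<close>

text \<open>For a polynomial in \<open>x\<close>, \<open>order 0\<close> is the exponent of \<open>x\<close>.\<close>

lift_definition xadic :: "'k::field poly fract \<Rightarrow> ereal"
  is "\<lambda>(p, q). if p = 0 then \<infinity> else ereal (real (order 0 p) - real (order 0 q))"
proof -
  fix f g :: "'k poly \<times> 'k poly"
  assume fg: "fractrel f g"
  obtain p q r s where f: "f = (p, q)" and g: "g = (r, s)" by (cases f, cases g)
  from fg have nz: "q \<noteq> 0" "s \<noteq> 0" and eq: "p * s = r * q" by (auto simp: f g)
  have iff: "p = 0 \<longleftrightarrow> r = 0" using nz eq by (metis mult_eq_0_iff)
  have "real (order 0 p) - real (order 0 q) = real (order 0 r) - real (order 0 s)" if "p \<noteq> 0"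
  proof -
    have "order 0 (p * s) = order 0 p + order 0 s" "order 0 (r * q) = order 0 r + order 0 q"
      using that iff nz by (auto intro!: order_mult)
    with eq show ?thesis by simp
  qed
  with iff show "?thesis f g" by (auto simp: f g)
qed

lemma xadic_Fract:
  "q \<noteq> 0 \<Longrightarrow> xadic (Fract p q)
     = (if p = 0 then \<infinity> else ereal (real (order 0 p) - real (order 0 q)))"
  by transfer simp

abbreviation yvar :: "'k::field Ky" where
  "yvar \<equiv> [:0, 1:]"

definition val_x :: "('k::field Ky \<Rightarrow> ereal) set" where
  "val_x = {\<nu>. (\<forall>f. \<nu> f \<noteq> -\<infinity>)
              \<and> (\<forall>f g. \<nu> (f + g) \<ge> min (\<nu> f) (\<nu> g))
              \<and> (\<forall>f g. \<nu> (f * g) = \<nu> f + \<nu> g)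
              \<and> \<nu> 0 = \<infinity>
              \<and> (\<forall>a. \<nu> [:a:] = xadic a)
              \<and> \<nu> yvar \<ge> 1}"

text \<open>The values of \<open>f / g\<close> with \<open>\<nu> g\<close> finite; in particular \<open>g \<noteq> 0\<close>.\<close>

definition aug_value_group :: "('k::field Ky \<Rightarrow> ereal) \<Rightarrow> ereal set" where
  "aug_value_group \<nu> = {\<nu> f - \<nu> g | f g. \<nu> g \<noteq> \<infinity>}"

subsection \<open>Truncations\<close>

text \<open>For \<open>degree Q \<ge> 1\<close> the coefficients of the \<open>Q\<close>-expansion of \<open>g\<close> are obtained by
  iterated division by \<open>Q\<close>; they vanish for \<open>j > degree g\<close>. See the two lemmas below.\<close>

definition exp_coeff :: "'k::field Ky \<Rightarrow> 'k Ky \<Rightarrow> nat \<Rightarrow> 'k Ky" where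
  "exp_coeff Q g j = (g div Q ^ j) mod Q"

lemma degree_exp_coeff:
  "degree Q \<ge> 1 \<Longrightarrow> degree (exp_coeff Q g j) < degree Q"
  using degree_mod_less[of Q "g div Q ^ j"] by (cases "Q = 0") (auto simp: exp_coeff_def)

lemma exp_coeff_expansion:
  fixes Q :: "'k::field Ky"
  assumes "degree Q \<ge> 1"
  shows "g = (\<Sum>j\<le>degree g. exp_coeff Q g j * Q ^ j)"
proof -
  have step: "g = (\<Sum>j<n. exp_coeff Q g j * Q ^ j) + (g div Q ^ n) * Q ^ n" for n
  proof (induction n)
    case (Suc n)
    have "g div Q ^ n = (g div Q ^ Suc n) * Q + exp_coeff Q g n"
      by (metis exp_coeff_def div_mult_mod_eq poly_div_mult_right power_Suc2)
    then have "(g div Q ^ n) * Q ^ n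
        = exp_coeff Q g n * Q ^ n + (g div Q ^ Suc n) * Q ^ Suc n"
      by (simp add: algebra_simps)
    with Suc show ?case by (simp add: add.assoc)
  qed simp
  have "Q \<noteq> 0" using assms by auto
  then have "degree (Q ^ Suc (degree g)) = Suc (degree g) * degree Q"
    using degree_power_eq by blast
  also have "\<dots> \<ge> Suc (degree g) * 1" using assms by (intro mult_le_mono) auto
  finally have "g div Q ^ Suc (degree g) = 0" by (intro div_poly_less) simp
  with step[of "Suc (degree g)"] show ?thesis by (simp add: lessThan_Suc_atMost)
qed

definition trunc :: "('k::field Ky \<Rightarrow> ereal) \<Rightarrow> 'k Ky \<Rightarrow> 'k Ky \<Rightarrow> ereal" where
  "trunc \<nu> Q g = Min ((\<lambda>j. \<nu> (exp_coeff Q g j * Q ^ j)) ` {..degree g})"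

subsection \<open>Key polynomials and complete sets\<close>

text \<open>The formal derivative \<open>\<partial>\<^sub>b = (1/b!) \<partial>\<^sup>b/\<partial>y\<^sup>b\<close>, meaningful in every characteristic:
  \<open>y\<^sup>i \<mapsto> (i choose b) y\<^sup>i\<^sup>-\<^sup>b\<close>.\<close>

definition hasse_deriv :: "nat \<Rightarrow> 'k::field Ky \<Rightarrow> 'k Ky" where
  "hasse_deriv b P = (\<Sum>i = b..degree P. monom (of_nat (i choose b) * coeff P i) (i - b))"

text \<open>The supremum is a maximum, since \<open>hasse_deriv b P = 0\<close> for \<open>b > degree P\<close>. The case
  distinction is needed because \<open>\<infinity> - \<infinity> = \<infinity>\<close> in \<^typ>\<open>ereal\<close>.\<close>

definition key_eps :: "('k::field Ky \<Rightarrow> ereal) \<Rightarrow> 'k Ky \<Rightarrow> ereal" where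
  "key_eps \<nu> P = (SUP b\<in>{1::nat..}.
     if \<nu> (hasse_deriv b P) = \<infinity> then -\<infinity>
     else (\<nu> P - \<nu> (hasse_deriv b P)) / ereal (real b))"

definition key_poly :: "('k::field Ky \<Rightarrow> ereal) \<Rightarrow> 'k Ky \<Rightarrow> bool" where
  "key_poly \<nu> Q \<longleftrightarrow> lead_coeff Q = 1 \<and> \<nu> Q \<ge> \<nu> yvar
     \<and> (\<forall>f. f \<noteq> 0 \<and> key_eps \<nu> f \<ge> key_eps \<nu> Q \<longrightarrow> degree f \<ge> degree Q)"

text \<open>The products \<open>a \<Prod>\<^sub>j Q\<^bsub>i j\<^esub>\<^bsup>\<gamma> j\<^esup>\<close> whose formal value \<open>\<nu> a + \<Sum>\<^sub>j \<gamma> j \<cdot> \<nu> Q\<^bsub>i j\<^esub>\<close> is at least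
  \<open>\<beta>\<close>; in \<^typ>\<open>ereal\<close>, \<open>0 * \<infinity> = 0\<close>.\<close>

definition key_products ::
  "('k::field Ky \<Rightarrow> ereal) \<Rightarrow> 'i set \<Rightarrow> ('i \<Rightarrow> 'k Ky) \<Rightarrow> ereal \<Rightarrow> 'k Ky set" where
  "key_products \<nu> I Q \<beta> =
     {[:a:] * (\<Prod>j = 1..s. Q (i j) ^ \<gamma> j) | a (s :: nat) i \<gamma>.
        (\<forall>j\<in>{1..s}. i j \<in> I)
        \<and> \<nu> [:a:] + (\<Sum>j = 1..s. ereal (real (\<gamma> j)) * \<nu> (Q (i j))) \<ge> \<beta>}"

definition complete_key_polys ::
  "('k::field Ky \<Rightarrow> ereal) \<Rightarrow> ('i::wellorder) set \<Rightarrow> ('i \<Rightarrow> 'k Ky) \<Rightarrow> bool" where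
  "complete_key_polys \<nu> I Q \<longleftrightarrow> (\<forall>i\<in>I. key_poly \<nu> (Q i))
     \<and> (\<forall>\<beta>\<in>aug_value_group \<nu>. {f. \<nu> f \<ge> \<beta>} = group_closure (key_products \<nu> I Q \<beta>))"

subsection \<open>The construction\<close>

text \<open>The argument \<open>Q\<close> below is \<open>Q\<^sub>n\<close>; the results are \<open>d\<^bsub>n+1\<^esub>(\<nu>)\<close>, \<open>\<Phi>\<^sub>n(\<nu>)\<close> and \<open>\<Psi>\<^sub>n(\<nu>)\<close>.\<close>

definition next_deg :: "('k::field Ky \<Rightarrow> ereal) \<Rightarrow> 'k Ky \<Rightarrow> nat" where
  "next_deg \<nu> Q = (LEAST d. \<exists>f. lead_coeff f = 1 \<and> degree f = d \<and> trunc \<nu> Q f < \<nu> f)"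

definition Phi :: "('k::field Ky \<Rightarrow> ereal) \<Rightarrow> 'k Ky \<Rightarrow> 'k Ky set" where
  "Phi \<nu> Q = {F. lead_coeff F = 1 \<and> degree F = next_deg \<nu> Q \<and> trunc \<nu> Q F < \<nu> F}"

definition Psi :: "('k::field Ky \<Rightarrow> ereal) \<Rightarrow> 'k Ky \<Rightarrow> ereal set" where
  "Psi \<nu> Q = \<nu> ` Phi \<nu> Q"

text \<open>\<open>construction \<nu> I Q\<close>: the family \<open>Q\<close>, relevant on \<open>I\<close> only, is a possible outcome of the
  construction and \<open>I\<close> is its index set \<open>I(\<nu>)\<close>. The conditions on \<open>I\<close> make it equal to
  \<open>{1..n}\<close> for the first \<open>n\<close> with \<open>\<nu>\<^sub>n = \<nu>\<close>, and to \<open>{1..}\<close> if there is none.\<close>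

definition construction ::
  "('k::field Ky \<Rightarrow> ereal) \<Rightarrow> nat set \<Rightarrow> (nat \<Rightarrow> 'k Ky) \<Rightarrow> bool" where
  "construction \<nu> I Q \<longleftrightarrow>
     0 \<notin> I \<and> 1 \<in> I
     \<and> (\<forall>n\<ge>1. n + 1 \<in> I \<longleftrightarrow> n \<in> I \<and> trunc \<nu> (Q n) \<noteq> \<nu>)
     \<and> Q 1 = yvar
     \<and> (\<forall>n\<ge>1. n + 1 \<in> I \<longrightarrow>
          Q (n + 1) \<in> Phi \<nu> (Q n) \<and> (\<forall>\<beta>\<in>Psi \<nu> (Q n). \<nu> (Q (n + 1)) \<le> \<beta>))"

end

theory Submission
  imports Defs
begin

text \<open>
  For \<open>\<delta> \<in> \<real>\<close> extend \<open>\<nu>\<close> to \<open>K[y][T]\<close> by the Gauss valuation with \<open>\<nu>(T) = \<delta>\<close> and put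
  \<open>w\<^sub>\<delta>(f) = \<nu>(f(y + T)) = min\<^sub>b (\<nu>(\<partial>\<^sub>b f) + b\<delta>)\<close>, so that \<open>\<epsilon>\<^sub>\<nu>(f) \<le> \<delta>\<close> iff \<open>w\<^sub>\<delta>(f) = \<nu>(f)\<close>. If \<open>Q\<close>
  is a key polynomial and \<open>\<delta> = \<epsilon>\<^sub>\<nu>(Q)\<close>, then initial forms in \<open>T\<close> show that \<open>w\<^sub>\<delta> = \<nu>\<^sub>Q\<close>. Hence a monic
  polynomial \<open>F\<close> of minimal degree with \<open>\<nu>\<^sub>Q(F) < \<nu>(F)\<close> has \<open>\<epsilon>\<^sub>\<nu>(F) > \<delta>\<close>, whereas \<open>\<epsilon>\<^sub>\<nu>(f) \<le> \<delta>\<close> for all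
  \<open>f\<close> of smaller degree: \<open>F\<close> is again a key polynomial.

  If \<open>deg Q\<^sub>n\<close> were constant for \<open>n \<ge> N\<close>, then the strictly increasing values \<open>\<nu>(Q\<^sub>n)\<close>, \<open>n > N\<close>, would all
  lie in one finite set \<open>\<Psi>\<^sub>N\<close>; so the degrees are unbounded. Thus every \<open>f\<close> satisfies \<open>\<nu>(f) = \<nu>\<^sub>n(f)\<close> for
  some \<open>n\<close>, and \<open>Q\<^sub>n\<close>-expansions write \<open>f\<close> as a sum of products of value at least \<open>\<nu>(f)\<close>; this also
  makes \<open>\<nu>\<close> finite on nonzero polynomials.
\<close>

subsection \<open>Taylor expansion\<close>

lemma coeff_hasse_deriv:
  "coeff (hasse_deriv b f) n = of_nat ((n + b) choose b) * coeff f (n + b)"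
proof -
  have "coeff (hasse_deriv b f) n
      = (\<Sum>i = b..degree f. if i = n + b then of_nat (i choose b) * coeff f i else 0)"
    unfolding hasse_deriv_def coeff_sum by (intro sum.cong) auto
  also have "\<dots> = of_nat ((n + b) choose b) * coeff f (n + b)"
    by (simp add: coeff_eq_0)
  finally show ?thesis .
qed

text \<open>This is f(y + T) in K[y][T]: \<open>map_poly\<close> turns the coefficients into
  constants of K[y][T], and \<open>[:yvar, 1:]\<close> is y + T.\<close>

definition taylor :: "'k::field Ky \<Rightarrow> 'k Ky poly" where
  "taylor f = poly (map_poly (\<lambda>c. [:[:c:]:]) f) [:yvar, 1:]"

lemma taylor_0 [simp]: "taylor 0 = 0"
  by (simp add: taylor_def)

lemma taylor_pCons: "taylor (pCons a f) = [:[:a:]:] + [:yvar, 1:] * taylor f"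
  by (simp add: taylor_def map_poly_pCons)

lemma taylor_add: "taylor (f + g) = taylor f + taylor g"
proof (induction f g rule: poly_induct2)
  case (pCons a p b q)
  have "taylor (pCons a p + pCons b q) = ([:[:a:]:] + [:[:b:]:]) + [:yvar, 1:] * (taylor p + taylor q)"
    by (simp add: taylor_pCons pCons.IH del: mult_pCons_left)
  then show ?case
    by (simp add: taylor_pCons distrib_left del: mult_pCons_left)
qed simp

lemma taylor_smult: "taylor (smult c f) = [:[:c:]:] * taylor f"
  by (induction f) (simp_all add: taylor_pCons algebra_simps)

lemma taylor_mult: "taylor (f * g) = taylor f * taylor g"
proof (induction f)
  case (pCons a f)
  have "taylor (pCons a f * g) = taylor (smult a g) + taylor (pCons 0 (f * g))"
    by (simp add: taylor_add)
  with pCons show ?case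
    by (simp add: taylor_smult taylor_pCons algebra_simps)
qed simp

text \<open>Comparing coefficients in \<open>taylor_pCons\<close> gives Pascal's rule for the
  binomials. Hasse derivatives thus inherit the Leibniz rule from
  \<open>taylor_mult\<close>.\<close>

lemma coeff_taylor: "coeff (taylor f) b = hasse_deriv b f"
proof -
  have "coeff (coeff (taylor f) b) n = of_nat ((n + b) choose b) * coeff f (n + b)" for n
  proof (induction f arbitrary: b n)
    case (pCons a f)
    show ?case
      by (cases b; cases n) (simp_all add: taylor_pCons pCons.IH algebra_simps)
  qed simp
  then show ?thesis by (intro poly_eqI) (simp add: coeff_hasse_deriv)
qed

lemma hasse_deriv_mult:
  "hasse_deriv b (f * g) = (\<Sum>i\<le>b. hasse_deriv i f * hasse_deriv (b - i) g)"
  by (simp flip: coeff_taylor add: taylor_mult coeff_mult)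

lemma hasse_deriv_0_left [simp]: "hasse_deriv 0 f = f"
  by (rule poly_eqI) (simp add: coeff_hasse_deriv)

lemma hasse_deriv_0_right [simp]: "hasse_deriv b 0 = 0"
  by (rule poly_eqI) (simp add: coeff_hasse_deriv)

lemma hasse_deriv_add: "hasse_deriv b (f + g) = hasse_deriv b f + hasse_deriv b g"
  by (rule poly_eqI) (simp add: coeff_hasse_deriv algebra_simps)

lemma hasse_deriv_sum: "hasse_deriv b (sum f A) = (\<Sum>x\<in>A. hasse_deriv b (f x))"
  by (induction A rule: infinite_finite_induct) (simp_all add: hasse_deriv_add)

lemma hasse_deriv_eq_0: "b > degree f \<Longrightarrow> hasse_deriv b f = 0"
  by (rule poly_eqI) (simp add: coeff_hasse_deriv coeff_eq_0)

lemma hasse_deriv_degree: "hasse_deriv (degree f) f = [:lead_coeff f:]"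
  by (rule poly_eqI) (auto simp: coeff_hasse_deriv coeff_eq_0 coeff_pCons split: nat.splits)

subsection \<open>Valuations\<close>

locale valuation_x =
  fixes \<nu> :: "'k::field Ky \<Rightarrow> ereal"
  assumes val_x: "\<nu> \<in> val_x"
begin

lemma val_not_minf [simp]: "\<nu> f \<noteq> -\<infinity>"
  and val_add: "min (\<nu> f) (\<nu> g) \<le> \<nu> (f + g)"
  and val_mult: "\<nu> (f * g) = \<nu> f + \<nu> g"
  and val_0 [simp]: "\<nu> 0 = \<infinity>"
  and val_const: "\<nu> [:a:] = xadic a"
  and val_y: "\<nu> yvar \<ge> 1"
  using val_x by (auto simp: val_x_def)

lemma val_const_finite: "a \<noteq> 0 \<Longrightarrow> \<nu> [:a:] \<noteq> \<infinity>"
  by (cases a rule: Fract_cases_nonzero) (auto simp: val_const xadic_Fract Zero_fract_def)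

lemma val_1 [simp]: "\<nu> 1 = 0"
proof -
  have "\<nu> [:1:] = 0"
    unfolding val_const One_fract_def by (subst xadic_Fract) (simp_all add: order_0I zero_ereal_def)
  then show ?thesis by (simp add: one_pCons)
qed

lemma val_minus [simp]: "\<nu> (- f) = \<nu> f"
proof -
  have "\<nu> (-1) + \<nu> (-1) = 0"
    using val_mult[of "-1" "-1"] by simp
  then have "\<nu> (-1) = 0"
    by (cases "\<nu> (-1)") (auto simp: zero_ereal_def)
  with val_mult[of "-1" f] show ?thesis by simp
qed

lemma val_diff: "min (\<nu> f) (\<nu> g) \<le> \<nu> (f - g)"
  using val_add[of f "- g"] by simp

lemma val_power: "\<nu> (f ^ n) = ereal (real n) * \<nu> f"
proof (induction n)
  case (Suc n)
  then show ?case
    by (cases "\<nu> f") (auto simp: val_mult algebra_simps)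
qed (simp flip: zero_ereal_def)

lemma val_prod: "\<nu> (prod f A) = (\<Sum>x\<in>A. \<nu> (f x))"
  by (induction A rule: infinite_finite_induct) (simp_all add: val_mult)

lemma val_sum_ge: "(\<And>x. x \<in> A \<Longrightarrow> m \<le> \<nu> (f x)) \<Longrightarrow> m \<le> \<nu> (sum f A)"
proof (induction A rule: infinite_finite_induct)
  case (insert x A)
  then have "m \<le> min (\<nu> (f x)) (\<nu> (sum f A))" by simp
  also have "\<dots> \<le> \<nu> (f x + sum f A)" by (rule val_add)
  finally show ?case using insert by simp
qed simp_all

lemma val_sum_gt:
  assumes "m \<noteq> \<infinity>" "\<And>x. x \<in> A \<Longrightarrow> m < \<nu> (f x)"
  shows "m < \<nu> (sum f A)"
  using assms(2)
proof (induction A rule: infinite_finite_induct)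
  case (insert x A)
  then have "m < min (\<nu> (f x)) (\<nu> (sum f A))" by simp
  also have "\<dots> \<le> \<nu> (f x + sum f A)" by (rule val_add)
  finally show ?case using insert by simp
qed (use assms(1) in simp_all)

text \<open>The bound for the sum is sharp because \<open>f\<close> can be recovered as
  \<open>(f + g) - g\<close>.\<close>

lemma val_add_eq: "\<nu> f < \<nu> g \<Longrightarrow> \<nu> (f + g) = \<nu> f"
  using val_add[of f g] val_diff[of "f + g" g] by (auto simp: min_def split: if_splits)

lemma val_sum_eq:
  assumes "finite A" "x \<in> A" "\<nu> (f x) = m" "m \<noteq> \<infinity>" "\<And>y. y \<in> A \<Longrightarrow> y \<noteq> x \<Longrightarrow> m < \<nu> (f y)"
  shows "\<nu> (sum f A) = m"
proof -
  have "\<nu> (f x) < \<nu> (sum f (A - {x}))"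
    using assms by (intro val_sum_gt) auto
  with val_add_eq[OF this] show ?thesis using assms by (simp add: sum.remove)
qed

text \<open>
  The polynomial \<open>f(y + T) = \<Sum>\<^sub>b \<partial>\<^sub>b f T\<^sup>b\<close> has value \<open>m\<close> for the Gauss extension of \<open>\<nu>\<close>
  with \<open>\<nu>(T) = \<delta>\<close>, and its initial form has degree \<open>e\<close> in \<open>T\<close>.
\<close>

definition taylor_initial :: "real \<Rightarrow> 'k Ky \<Rightarrow> real \<Rightarrow> nat \<Rightarrow> bool" where
  "taylor_initial \<delta> f m e \<longleftrightarrow>
     (\<forall>b. ereal m \<le> \<nu> (hasse_deriv b f) + ereal (real b * \<delta>))
     \<and> \<nu> (hasse_deriv e f) + ereal (real e * \<delta>) = ereal m
     \<and> (\<forall>b>e. ereal m < \<nu> (hasse_deriv b f) + ereal (real b * \<delta>))"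

text \<open>\<open>m\<close> is the minimum of the shifted values, and \<open>e\<close> is the last
  index at which it is attained.\<close>

lemma taylor_initial_unique:
  assumes "taylor_initial \<delta> f m e" "taylor_initial \<delta> f m' e'"
  shows "m = m'" "e = e'"
proof -
  show "m = m'"
    using assms unfolding taylor_initial_def by (metis ereal_less_eq(3) order_antisym)
  with assms show "e = e'"
    unfolding taylor_initial_def by (metis less_irrefl linorder_neqE_nat)
qed

text \<open>Moving the finite shift to the real side leaves a single, possibly infinite, value to
  compare.\<close>

lemma taylor_initial_iff:
  "taylor_initial \<delta> f m e \<longleftrightarrow>
     (\<forall>b. ereal (m - real b * \<delta>) \<le> \<nu> (hasse_deriv b f))
     \<and> \<nu> (hasse_deriv e f) = ereal (m - real e * \<delta>)
     \<and> (\<forall>b>e. ereal (m - real b * \<delta>) < \<nu> (hasse_deriv b f))"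
proof -
  have "ereal m \<le> v + ereal t \<longleftrightarrow> ereal (m - t) \<le> v"
    "v + ereal t = ereal m \<longleftrightarrow> v = ereal (m - t)"
    "ereal m < v + ereal t \<longleftrightarrow> ereal (m - t) < v" for v t
    by (cases v; auto)+
  then show ?thesis by (simp add: taylor_initial_def)
qed

text \<open>This is Gauss's lemma. In the Leibniz sum for index \<open>e + e'\<close>, every summand
  other than \<open>i = e\<close> has one factor beyond its last minimal index, so exactly one
  summand attains the minimum. Beyond \<open>e + e'\<close> no summand attains it.\<close>

lemma taylor_initial_mult:
  assumes f: "taylor_initial \<delta> f m e" and g: "taylor_initial \<delta> g m' e'"
  shows "taylor_initial \<delta> (f * g) (m + m') (e + e')"
proof -
  let ?v = "\<lambda>m b. ereal (m - real b * \<delta>)"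
  let ?t = "\<lambda>b i. hasse_deriv i f * hasse_deriv (b - i) g"
  have split: "?v (m + m') b = ?v m i + ?v m' (b - i)" if "i \<le> b" for b i
    using that by (simp add: algebra_simps of_nat_diff)
  have ge: "?v (m + m') b \<le> \<nu> (?t b i)" if "i \<le> b" for b i
    using f g unfolding split[OF that] val_mult taylor_initial_iff by (intro add_mono) auto
  have gt: "?v (m + m') b < \<nu> (?t b i)" if "i \<le> b" "e < i \<or> e' < b - i" for b i
    using that(2)
  proof
    assume "e < i"
    with f g have "?v m i < \<nu> (hasse_deriv i f)" "?v m' (b - i) \<le> \<nu> (hasse_deriv (b - i) g)"
      by (auto simp: taylor_initial_iff)
    then show ?thesis unfolding split[OF that(1)] val_mult
      by (cases "\<nu> (hasse_deriv i f)"; cases "\<nu> (hasse_deriv (b - i) g)") auto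
  next
    assume "e' < b - i"
    with f g have "?v m i \<le> \<nu> (hasse_deriv i f)" "?v m' (b - i) < \<nu> (hasse_deriv (b - i) g)"
      by (auto simp: taylor_initial_iff)
    then show ?thesis unfolding split[OF that(1)] val_mult
      by (cases "\<nu> (hasse_deriv i f)"; cases "\<nu> (hasse_deriv (b - i) g)") auto
  qed
  have eq: "\<nu> (?t (e + e') e) = ?v (m + m') (e + e')"
    using f g by (simp add: taylor_initial_iff val_mult algebra_simps)
  show ?thesis
    unfolding taylor_initial_iff hasse_deriv_mult
  proof (intro conjI allI impI)
    show "\<nu> (sum (?t (e + e')) {..e + e'}) = ?v (m + m') (e + e')"
    proof (rule val_sum_eq[where x = e and f = "?t (e + e')", OF _ _ eq])
      fix i assume "i \<in> {..e + e'}" "i \<noteq> e"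
      then show "?v (m + m') (e + e') < \<nu> (?t (e + e') i)" by (intro gt) auto
    qed auto
    show "?v (m + m') b < \<nu> (sum (?t b) {..b})" if "b > e + e'" for b
      using that by (intro val_sum_gt gt) auto
    show "?v (m + m') b \<le> \<nu> (sum (?t b) {..b})" for b
      by (intro val_sum_ge ge) auto
  qed
qed

lemma taylor_initial_1: "taylor_initial \<delta> 1 0 0"
proof -
  have "hasse_deriv b (1 :: 'k Ky) = 0" if "b > 0" for b
    using that by (simp add: hasse_deriv_eq_0)
  then have "\<nu> (hasse_deriv b 1) = (if b = 0 then 0 else \<infinity>)" for b
    by simp
  then show ?thesis
    by (simp add: taylor_initial_iff zero_ereal_def)
qed

lemma taylor_initial_power:
  "taylor_initial \<delta> f m e \<Longrightarrow> taylor_initial \<delta> (f ^ n) (real n * m) (n * e)"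
proof (induction n)
  case (Suc n)
  have "taylor_initial \<delta> (f * f ^ n) (m + real n * m) (e + n * e)"
    using Suc by (intro taylor_initial_mult) auto
  then show ?case by (simp add: algebra_simps)
qed (simp add: taylor_initial_1)

text \<open>No summand can cancel the coefficient of \<open>f J\<close> at index \<open>e\<close>:
  each other one has either a larger value or an initial form of smaller degree in T.\<close>

lemma taylor_initial_sum:
  assumes "finite A" "J \<in> A" and J: "taylor_initial \<delta> (f J) m e"
    and other: "\<And>j. j \<in> A \<Longrightarrow> j \<noteq> J \<Longrightarrow> f j = 0 \<or>
      (\<exists>m' e'. taylor_initial \<delta> (f j) m' e' \<and> m \<le> m' \<and> (m' = m \<longrightarrow> e' < e))"
  shows "taylor_initial \<delta> (sum f A) m e"
proof -
  let ?v = "\<lambda>b. ereal (m - real b * \<delta>)"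
  have ge: "?v b \<le> \<nu> (hasse_deriv b (f j))" if "j \<in> A" "j \<noteq> J" for b j
    using other[OF that]
  proof
    assume "\<exists>m' e'. taylor_initial \<delta> (f j) m' e' \<and> m \<le> m' \<and> (m' = m \<longrightarrow> e' < e)"
    then obtain m' e' where *: "taylor_initial \<delta> (f j) m' e'" "m \<le> m'" by blast
    then have "?v b \<le> ereal (m' - real b * \<delta>)" by simp
    also have "\<dots> \<le> \<nu> (hasse_deriv b (f j))" using * by (auto simp: taylor_initial_iff)
    finally show ?thesis .
  qed simp
  have gt: "?v b < \<nu> (hasse_deriv b (f j))" if "j \<in> A" "j \<noteq> J" "e \<le> b" for b j
    using other[OF that(1,2)]
  proof
    assume "\<exists>m' e'. taylor_initial \<delta> (f j) m' e' \<and> m \<le> m' \<and> (m' = m \<longrightarrow> e' < e)"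
    then obtain m' e' where *: "taylor_initial \<delta> (f j) m' e'" "m \<le> m'" "m' = m \<longrightarrow> e' < e"
      by blast
    show ?thesis
    proof (cases "m' = m")
      case True
      with * that show ?thesis by (auto simp: taylor_initial_iff)
    next
      case False
      then have "?v b < ereal (m' - real b * \<delta>)" using * by simp
      also have "\<dots> \<le> \<nu> (hasse_deriv b (f j))" using * by (auto simp: taylor_initial_iff)
      finally show ?thesis .
    qed
  qed simp
  show ?thesis
    unfolding taylor_initial_iff hasse_deriv_sum
  proof (intro conjI allI impI)
    show "?v b \<le> \<nu> (\<Sum>j\<in>A. hasse_deriv b (f j))" for b
      using ge J by (intro val_sum_ge) (metis taylor_initial_iff)
    show "?v b < \<nu> (\<Sum>j\<in>A. hasse_deriv b (f j))" if "b > e" for b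
      using gt J that by (intro val_sum_gt) (simp, metis taylor_initial_iff less_imp_le)
    show "\<nu> (\<Sum>j\<in>A. hasse_deriv e (f j)) = ?v e"
      using assms gt J by (intro val_sum_eq[of A J]) (auto simp: taylor_initial_iff)
  qed
qed

subsection \<open>Truncations\<close>

lemma trunc_le:
  assumes "degree Q \<ge> 1"
  shows "trunc \<nu> Q f \<le> \<nu> f"
  by (subst (2) exp_coeff_expansion[OF assms, of f], rule val_sum_ge) (simp add: trunc_def)

lemma trunc_eq_val: "degree f < degree Q \<Longrightarrow> trunc \<nu> Q f = \<nu> f"
proof -
  assume d: "degree f < degree Q"
  have "\<nu> (exp_coeff Q f j * Q ^ j) = (if j = 0 then \<nu> f else \<infinity>)" for j
  proof (cases "j = 0")
    case False
    then have "f div Q ^ j = 0"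
      using d by (intro div_poly_less) (cases "Q = 0"; cases j; auto simp: degree_mult_eq degree_power_eq)
    with False show ?thesis by (simp add: exp_coeff_def)
  qed (use d in \<open>simp add: exp_coeff_def mod_poly_less\<close>)
  then show ?thesis
    unfolding trunc_def by (intro Min_eqI) (auto intro: image_eqI[where x = 0])
qed

lemma degree_ge_of_trunc_less: "trunc \<nu> Q f < \<nu> f \<Longrightarrow> degree Q \<le> degree f"
  using trunc_eq_val[of f Q] by force

text \<open>Terms with a factor \<open>Q\<close> have infinite value, and \<open>f mod Q\<close>
  differs from \<open>f\<close> by such a term. Consequently a construction that never stops only
  meets \<open>Q\<close> of finite value.\<close>

lemma trunc_eq_of_val_infty:
  assumes "degree Q \<ge> 1" "\<nu> Q = \<infinity>"
  shows "trunc \<nu> Q = \<nu>"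
proof
  fix f
  have "\<nu> f \<le> \<nu> (exp_coeff Q f j * Q ^ j)" for j
  proof (cases j)
    case 0
    have "f mod Q = f - (f div Q) * Q" by (simp add: minus_div_mult_eq_mod)
    then have "\<nu> f \<le> \<nu> (f mod Q)"
      using val_diff[of f "(f div Q) * Q"] assms by (simp add: val_mult)
    then show ?thesis using 0 by (simp add: exp_coeff_def)
  qed (use assms in \<open>simp add: val_mult\<close>)
  then have "\<nu> f \<le> trunc \<nu> Q f" by (simp add: trunc_def)
  with trunc_le[OF assms(1)] show "trunc \<nu> Q f = \<nu> f" by (rule antisym)
qed

lemma trunc_smult: "c \<noteq> 0 \<Longrightarrow> trunc \<nu> Q (smult c f) = \<nu> [:c:] + trunc \<nu> Q f"
proof -
  assume c: "c \<noteq> 0"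
  have smult: "\<nu> (smult c g) = \<nu> [:c:] + \<nu> g" for g
    using val_mult[of "[:c:]" g] by simp
  have "(\<lambda>j. \<nu> (exp_coeff Q (smult c f) j * Q ^ j)) ` {..degree f}
      = (\<lambda>v. \<nu> [:c:] + v) ` (\<lambda>j. \<nu> (exp_coeff Q f j * Q ^ j)) ` {..degree f}"
    unfolding image_image
    by (intro image_cong) (simp_all add: exp_coeff_def div_smult_left mod_smult_left smult)
  moreover have "mono (\<lambda>v. \<nu> [:c:] + v)" by (intro monoI add_left_mono)
  ultimately show ?thesis
    using c by (simp add: trunc_def mono_Min_commute)
qed

text \<open>The minimum in \<open>next_deg\<close> ranges over monic polynomials only. Dividing by
  the leading coefficient shifts the value and the truncated value by the same finite
  amount.\<close>

lemma next_deg_le: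
  assumes "trunc \<nu> Q f < \<nu> f"
  shows "next_deg \<nu> Q \<le> degree f"
proof -
  have "f \<noteq> 0"
    using assms by (auto simp: trunc_def exp_coeff_def)
  define c where "c = inverse (lead_coeff f)"
  have c: "c \<noteq> 0" using \<open>f \<noteq> 0\<close> by (simp add: c_def)
  have "\<nu> (smult c f) = \<nu> [:c:] + \<nu> f"
    using val_mult[of "[:c:]" f] by simp
  then have "trunc \<nu> Q (smult c f) < \<nu> (smult c f)"
    using assms c val_const_finite[OF c]
    by (cases "\<nu> [:c:]"; cases "\<nu> f"; cases "trunc \<nu> Q f") (auto simp: trunc_smult)
  then show ?thesis
    unfolding next_deg_def using c \<open>f \<noteq> 0\<close>
    by (intro Least_le exI[of _ "smult c f"]) (simp add: c_def)
qed

lemma trunc_eq_below_next_deg: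
  assumes "degree Q \<ge> 1" "degree f < next_deg \<nu> Q"
  shows "trunc \<nu> Q f = \<nu> f"
proof (rule antisym)
  show "trunc \<nu> Q f \<le> \<nu> f" by (rule trunc_le[OF assms(1)])
  show "\<nu> f \<le> trunc \<nu> Q f" using assms next_deg_le[of Q f] by force
qed

lemma trunc_monic_same_degree:
  assumes "degree Q \<ge> 1" "degree F = degree Q" "lead_coeff Q = 1" "lead_coeff F = 1"
  shows "trunc \<nu> Q F = min (\<nu> (F - Q)) (\<nu> Q)"
proof -
  have "degree (F - Q) < degree Q"
    using assms by (intro degree_lessI) (auto simp: le_less coeff_eq_0)
  moreover have Q: "Q \<noteq> 0" using assms by auto
  ultimately have dm: "F div Q = 1" "F mod Q = F - Q"
    using div_poly_less[of "F - Q" Q] mod_poly_less[of "F - Q" Q]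
      div_mult_self1[of Q "F - Q" 1] mod_mult_self1[of "F - Q" Q 1]
    by auto
  have terms: "\<nu> (exp_coeff Q F j * Q ^ j)
      = (if j = 0 then \<nu> (F - Q) else if j = 1 then \<nu> Q else \<infinity>)" for j
  proof -
    have "F div Q ^ j = 0" if "j \<ge> 2"
    proof (rule div_poly_less)
      have "1 * degree Q < j * degree Q" using assms that by (intro mult_strict_right_mono) auto
      then show "degree F < degree (Q ^ j)"
        unfolding degree_power_eq[OF Q] assms(2) by simp
    qed
    moreover have "1 mod Q = 1"
      using assms by (intro mod_poly_less) simp
    ultimately show ?thesis
      using dm by (cases "j = 0"; cases "j = 1") (auto simp: exp_coeff_def)
  qed
  show ?thesis
    unfolding trunc_def terms
  proof (rule Min_eqI)
    let ?g = "\<lambda>j::nat. if j = 0 then \<nu> (F - Q) else if j = 1 then \<nu> Q else \<infinity>"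
    have "?g 0 \<in> ?g ` {..degree F}" "?g 1 \<in> ?g ` {..degree F}"
      using assms by (intro imageI; simp)+
    then show "min (\<nu> (F - Q)) (\<nu> Q) \<in> ?g ` {..degree F}" by (simp add: min_def)
  qed auto
qed

text \<open>If \<open>\<nu> (F - Q) < \<nu> Q\<close>, then \<open>F\<close> and its truncation both
  have the value of \<open>F - Q\<close>; otherwise the truncated value is \<open>\<nu> Q\<close>.
  So as long as the degree stays constant, a step of the construction just increases the
  value.\<close>

lemma trunc_less_monic_same_degree:
  assumes "degree Q \<ge> 1" "degree F = degree Q" "lead_coeff Q = 1" "lead_coeff F = 1"
  shows "trunc \<nu> Q F < \<nu> F \<longleftrightarrow> \<nu> Q < \<nu> F"
proof -
  have "\<nu> F = \<nu> (F - Q)" if "\<nu> (F - Q) < \<nu> Q"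
    using val_add_eq[OF that] by simp
  then show ?thesis
    unfolding trunc_monic_same_degree[OF assms]
    by (cases "\<nu> (F - Q)" "\<nu> Q" rule: linorder_cases) auto
qed

end

subsection \<open>Valuations with trivial support\<close>

text \<open>Finite values permit real arithmetic through \<open>rval\<close>. For the constructed
  sequence this assumption is established in \<open>finite_valuation\<close>, from properties of
  truncations alone.\<close>

locale finite_valuation_x = valuation_x +
  assumes val_finite: "f \<noteq> 0 \<Longrightarrow> \<nu> f \<noteq> \<infinity>"
begin

definition rval :: "'a Ky \<Rightarrow> real" where
  "rval f = real_of_ereal (\<nu> f)"

lemma val_eq_rval: "f \<noteq> 0 \<Longrightarrow> \<nu> f = ereal (rval f)"
  using val_finite[of f] by (cases "\<nu> f") (auto simp: rval_def)

lemma val_eq_infty_iff [simp]: "\<nu> f = \<infinity> \<longleftrightarrow> f = 0"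
  using val_finite[of f] by auto

lemma rval_mult: "f \<noteq> 0 \<Longrightarrow> g \<noteq> 0 \<Longrightarrow> rval (f * g) = rval f + rval g"
  using val_mult[of f g] by (simp add: val_eq_rval)

lemma rval_power: "f \<noteq> 0 \<Longrightarrow> rval (f ^ n) = real n * rval f"
  using val_power[of f n] by (simp add: val_eq_rval)

definition eps_term :: "'a Ky \<Rightarrow> nat \<Rightarrow> ereal" where
  "eps_term f b = (if \<nu> (hasse_deriv b f) = \<infinity> then -\<infinity>
     else (\<nu> f - \<nu> (hasse_deriv b f)) / ereal (real b))"

lemma key_eps_eq: "key_eps \<nu> f = (SUP b\<in>{1..}. eps_term f b)"
  by (simp add: key_eps_def eps_term_def)

lemma eps_term_le_iff:
  assumes "f \<noteq> 0" "b \<ge> 1"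
  shows "eps_term f b \<le> ereal \<delta> \<longleftrightarrow> ereal (rval f - real b * \<delta>) \<le> \<nu> (hasse_deriv b f)"
  using assms by (cases "\<nu> (hasse_deriv b f)") (auto simp: eps_term_def val_eq_rval field_simps)

lemma eps_term_less_iff:
  assumes "f \<noteq> 0" "b \<ge> 1"
  shows "eps_term f b < ereal \<delta> \<longleftrightarrow> ereal (rval f - real b * \<delta>) < \<nu> (hasse_deriv b f)"
  using assms by (cases "\<nu> (hasse_deriv b f)") (auto simp: eps_term_def val_eq_rval field_simps)

text \<open>The right-hand side says that f(y + T), with T of value \<open>\<delta>\<close>, has the
  same value as \<open>f\<close>. The index 0, absent from \<open>key_eps\<close>, contributes an
  equality.\<close>

lemma key_eps_le_iff:
  assumes "f \<noteq> 0"
  shows "key_eps \<nu> f \<le> ereal \<delta> \<longleftrightarrow>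
    (\<forall>b. ereal (rval f - real b * \<delta>) \<le> \<nu> (hasse_deriv b f))"
proof -
  have "key_eps \<nu> f \<le> ereal \<delta> \<longleftrightarrow>
      (\<forall>b\<ge>1. ereal (rval f - real b * \<delta>) \<le> \<nu> (hasse_deriv b f))"
    using eps_term_le_iff[OF assms] by (auto simp: key_eps_eq SUP_le_iff)
  also have "\<dots> \<longleftrightarrow> (\<forall>b. ereal (rval f - real b * \<delta>) \<le> \<nu> (hasse_deriv b f))"
    using assms by (metis One_nat_def Suc_leI diff_zero hasse_deriv_0_left mult_zero_left
        neq0_conv of_nat_0 order_refl val_eq_rval)
  finally show ?thesis .
qed

lemma taylor_initial_of_key_eps_less:
  assumes "f \<noteq> 0" "key_eps \<nu> f < ereal \<delta>"
  shows "taylor_initial \<delta> f (rval f) 0"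
proof -
  have "eps_term f b < ereal \<delta>" if "b \<ge> 1" for b
    using that assms(2) unfolding key_eps_eq by (auto dest: SUP_lessD)
  then have "ereal (rval f - real b * \<delta>) < \<nu> (hasse_deriv b f)" if "b \<ge> 1" for b
    using that eps_term_less_iff[OF assms(1)] by blast
  moreover have "\<forall>b. ereal (rval f - real b * \<delta>) \<le> \<nu> (hasse_deriv b f)"
    using assms key_eps_le_iff less_imp_le by blast
  ultimately show ?thesis
    using assms(1) by (simp add: taylor_initial_iff val_eq_rval)
qed

text \<open>Derivatives beyond the degree vanish, so the supremum is a maximum over finitely many
  indices. The last index attaining it serves as \<open>e\<close>.\<close>

lemma taylor_initial_key_eps:
  assumes "degree f \<ge> 1"
  obtains \<delta> e where "key_eps \<nu> f = ereal \<delta>" "e \<ge> 1" "taylor_initial \<delta> f (rval f) e"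
proof -
  have f: "f \<noteq> 0" using assms by auto
  define M where "M = Max (eps_term f ` {1..degree f})"
  have le_M: "eps_term f b \<le> M" if "b \<ge> 1" for b
  proof (cases "b \<le> degree f")
    case True
    then show ?thesis using that unfolding M_def by (intro Max_ge) auto
  next
    case False
    then show ?thesis by (simp add: eps_term_def hasse_deriv_eq_0)
  qed
  have "M \<in> eps_term f ` {1..degree f}"
    using assms unfolding M_def by (intro Max_in) auto
  then obtain b0 where b0: "b0 \<in> {1..degree f}" "M = eps_term f b0" by blast
  have eps: "key_eps \<nu> f = M"
    unfolding key_eps_eq using le_M b0 by (intro antisym SUP_least) (auto intro: SUP_upper)
  \<comment> \<open>The top derivative is a nonzero constant, which keeps the maximum away from
    \<open>-\<infinity>\<close>.\<close>
  have "\<nu> (hasse_deriv (degree f) f) \<noteq> \<infinity>"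
    using f by (simp add: hasse_deriv_degree)
  then have "eps_term f (degree f) \<noteq> -\<infinity>"
    using assms f by (cases "\<nu> (hasse_deriv (degree f) f)") (auto simp: eps_term_def val_eq_rval)
  moreover have "eps_term f b0 \<noteq> \<infinity>"
    using b0 f by (cases "\<nu> (hasse_deriv b0 f)") (auto simp: eps_term_def val_eq_rval)
  ultimately obtain \<delta> where \<delta>: "M = ereal \<delta>"
    using le_M[OF assms] unfolding b0(2)[symmetric] by (cases M) auto
  define S where "S = {b \<in> {1..degree f}. eps_term f b = M}"
  define e where "e = Max S"
  have S: "finite S" "b0 \<in> S" using b0 by (auto simp: S_def)
  then have "e \<in> S" unfolding e_def by (intro Max_in) auto
  then have e: "e \<ge> 1" "eps_term f e = ereal \<delta>" by (auto simp: S_def \<delta>)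
  have "eps_term f b < ereal \<delta>" if "b > e" for b
  proof -
    have "b \<notin> S" using that Max_ge[OF S(1), of b] by (metis e_def leD)
    have "eps_term f b \<noteq> M"
    proof (cases "b \<le> degree f")
      case True
      with \<open>b \<notin> S\<close> that show ?thesis by (simp add: S_def)
    next
      case False
      then have "eps_term f b = -\<infinity>" by (simp add: eps_term_def hasse_deriv_eq_0)
      then show ?thesis unfolding \<delta> by simp
    qed
    with le_M[of b] that e show ?thesis by (simp add: \<delta> less_le)
  qed
  then have gt: "ereal (rval f - real b * \<delta>) < \<nu> (hasse_deriv b f)" if "b > e" for b
    using that e(1) eps_term_less_iff[OF f, of b \<delta>] by simp
  have ge: "\<forall>b. ereal (rval f - real b * \<delta>) \<le> \<nu> (hasse_deriv b f)"
    using key_eps_le_iff[OF f, of \<delta>] eps \<delta> by simp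
  have "\<not> ereal (rval f - real e * \<delta>) < \<nu> (hasse_deriv e f)"
    using e eps_term_less_iff[OF f e(1), of \<delta>] by simp
  with ge have "\<nu> (hasse_deriv e f) = ereal (rval f - real e * \<delta>)"
    by (metis less_le)
  with ge gt have "taylor_initial \<delta> f (rval f) e"
    by (simp add: taylor_initial_iff)
  with eps \<delta> e that show thesis by blast
qed

end

section \<open>Key polynomials: truncated values as values of initial forms\<close>

lemma degree_div_mult_le: "degree (a div b * b) \<le> degree a" for a b :: "'a::field poly"
proof (cases "degree a < degree b \<or> b = 0")
  case False
  then have "degree (a mod b) \<le> degree a"
    using degree_mod_less[of b a] by auto
  then have "degree (a - a mod b) \<le> degree a"
    by (intro degree_diff_le) auto
  then show ?thesis by (simp add: minus_mod_eq_div_mult)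
qed (auto simp: div_poly_less)

text \<open>
  Every key polynomial \<open>Q\<close> satisfies this with \<open>\<delta> = \<epsilon>\<^sub>\<nu>(Q)\<close>: the initial form of \<open>Q(y + T)\<close>
  involves \<open>T\<close>, those of the polynomials of smaller degree do not.
\<close>

locale key_polynomial = finite_valuation_x +
  fixes Q :: "'a Ky" and \<delta> :: real and e :: nat
  assumes degree_Q: "degree Q \<ge> 1" and monic_Q: "lead_coeff Q = 1"
    and e_pos: "e \<ge> 1" and initial_Q: "taylor_initial \<delta> Q (rval Q) e"
    and initial_small: "\<And>c. c \<noteq> 0 \<Longrightarrow> degree c < degree Q \<Longrightarrow> taylor_initial \<delta> c (rval c) 0"
begin

lemma Q_nz [simp]: "Q \<noteq> 0"
  using degree_Q by auto

text \<open>A nonzero term \<open>c j * Q ^ j\<close> has an initial form of degree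
  \<open>j * e\<close> in T. As \<open>e\<close> is positive, terms of equal value have different
  degrees, and among those of minimal value the one with the largest index \<open>J\<close>
  dominates.\<close>

lemma expansion_initial:
  assumes "\<And>j. j \<le> N \<Longrightarrow> degree (c j) < degree Q" "i \<le> N" "c i \<noteq> 0"
  obtains J m where "J \<le> N" "taylor_initial \<delta> (\<Sum>j\<le>N. c j * Q ^ j) m (J * e)"
    "\<nu> (c J * Q ^ J) = ereal m" "\<forall>j\<le>N. ereal m \<le> \<nu> (c j * Q ^ j)"
    "\<forall>j\<le>N. j > J \<longrightarrow> ereal m < \<nu> (c j * Q ^ j)"
proof -
  define r where "r j = rval (c j * Q ^ j)" for j
  define V where "V = {j. j \<le> N \<and> c j \<noteq> 0}"
  have V: "finite V" "i \<in> V" using assms by (auto simp: V_def)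
  define m where "m = Min (r ` V)"
  have m_le: "m \<le> r j" if "j \<in> V" for j using V that by (auto simp: m_def)
  have "m \<in> r ` V" unfolding m_def using V by (intro Min_in) auto
  define S where "S = {j \<in> V. r j = m}"
  define J where "J = Max S"
  have "finite S" "S \<noteq> {}" using V \<open>m \<in> r ` V\<close> by (auto simp: S_def)
  then have "J \<in> S" and J_max: "\<And>j. j \<in> S \<Longrightarrow> j \<le> J" unfolding J_def by auto
  then have J: "J \<le> N" "c J \<noteq> 0" "r J = m" by (auto simp: S_def V_def)
  have val: "\<nu> (c j * Q ^ j) = (if j \<in> V then ereal (r j) else \<infinity>)" if "j \<le> N" for j
    using that by (auto simp: V_def r_def val_eq_rval)
  have init: "taylor_initial \<delta> (c j * Q ^ j) (r j) (j * e)" if "j \<in> V" for j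
    using taylor_initial_mult[OF initial_small taylor_initial_power[OF initial_Q], of "c j" j] that
      assms(1)[of j] by (auto simp: V_def r_def rval_mult rval_power)
  show thesis
  proof (rule that[of J m])
    show "taylor_initial \<delta> (\<Sum>j\<le>N. c j * Q ^ j) m (J * e)"
    proof (rule taylor_initial_sum[of _ J])
      show "taylor_initial \<delta> (c J * Q ^ J) m (J * e)" using init[of J] J by (auto simp: V_def)
      fix j assume j: "j \<in> {..N}" "j \<noteq> J"
      show "c j * Q ^ j = 0 \<or> (\<exists>m' e'. taylor_initial \<delta> (c j * Q ^ j) m' e' \<and> m \<le> m'
          \<and> (m' = m \<longrightarrow> e' < J * e))"
      proof (cases "j \<in> V")
        case True
        have "j * e < J * e" if "r j = m"
          using that True j J_max[of j] e_pos by (auto simp: S_def)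
        then show ?thesis using init[OF True] m_le[OF True] by blast
      qed (use j in \<open>auto simp: V_def\<close>)
    qed (use J in auto)
    show "\<nu> (c J * Q ^ J) = ereal m" using J val[of J] by (auto simp: V_def)
    show "\<forall>j\<le>N. ereal m \<le> \<nu> (c j * Q ^ j)"
      using val m_le by simp
    show "\<forall>j\<le>N. j > J \<longrightarrow> ereal m < \<nu> (c j * Q ^ j)"
    proof (intro allI impI)
      fix j assume "j \<le> N" "j > J"
      then show "ereal m < \<nu> (c j * Q ^ j)"
        using val[of j] m_le[of j] J_max[of j] by (auto simp: S_def less_le)
    qed
  qed (use J in auto)
qed

text \<open>The dominant term of the expansion determines both sides, so the truncated value is the
  Gauss value of f(y + T).\<close>

lemma trunc_initial:
  assumes "f \<noteq> 0"
  obtains m J where "trunc \<nu> Q f = ereal m" "taylor_initial \<delta> f m (J * e)"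
proof -
  let ?N = "degree f"
  have "\<exists>i\<le>?N. exp_coeff Q f i \<noteq> 0"
  proof (rule ccontr)
    assume "\<not> ?thesis"
    then have "(\<Sum>j\<le>?N. exp_coeff Q f j * Q ^ j) = 0" by simp
    then have "f = 0" unfolding exp_coeff_expansion[OF degree_Q, of f, symmetric] .
    with assms show False ..
  qed
  then obtain i where i: "i \<le> ?N" "exp_coeff Q f i \<noteq> 0" by blast
  obtain m J where *: "J \<le> ?N" "taylor_initial \<delta> (\<Sum>j\<le>?N. exp_coeff Q f j * Q ^ j) m (J * e)"
    "\<nu> (exp_coeff Q f J * Q ^ J) = ereal m"
    "\<forall>j\<le>?N. ereal m \<le> \<nu> (exp_coeff Q f j * Q ^ j)"
    "\<forall>j\<le>?N. j > J \<longrightarrow> ereal m < \<nu> (exp_coeff Q f j * Q ^ j)"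
    by (rule expansion_initial[of ?N "exp_coeff Q f" i, OF degree_exp_coeff[OF degree_Q] i])
  have "trunc \<nu> Q f = ereal m"
    unfolding trunc_def
  proof (rule Min_eqI)
    show "ereal m \<in> (\<lambda>j. \<nu> (exp_coeff Q f j * Q ^ j)) ` {..?N}"
      using *(1) *(3)[symmetric] by (intro image_eqI[of _ _ J]) auto
    show "ereal m \<le> v" if "v \<in> (\<lambda>j. \<nu> (exp_coeff Q f j * Q ^ j)) ` {..?N}" for v
      using that *(4) by blast
  qed simp
  moreover have "taylor_initial \<delta> f m (J * e)"
    using *(2) unfolding exp_coeff_expansion[OF degree_Q, of f, symmetric] .
  ultimately show thesis by (rule that)
qed

text \<open>Any coefficients of degree below \<open>degree Q\<close> may be used here: the
  truncation and the minimum over the given terms both describe the initial form of the same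
  polynomial, and \<open>taylor_initial_unique\<close> equates them.\<close>

lemma trunc_expansion:
  assumes "\<And>j. j \<le> N \<Longrightarrow> degree (c j) < degree Q" "i \<le> N" "c i \<noteq> 0"
  obtains J m where "J \<le> N" "taylor_initial \<delta> (\<Sum>j\<le>N. c j * Q ^ j) m (J * e)"
    "trunc \<nu> Q (\<Sum>j\<le>N. c j * Q ^ j) = ereal m"
    "\<nu> (c J * Q ^ J) = ereal m" "\<forall>j\<le>N. ereal m \<le> \<nu> (c j * Q ^ j)"
    "\<forall>j\<le>N. j > J \<longrightarrow> ereal m < \<nu> (c j * Q ^ j)"
proof -
  obtain m J where *: "J \<le> N" "taylor_initial \<delta> (\<Sum>j\<le>N. c j * Q ^ j) m (J * e)"
    "\<nu> (c J * Q ^ J) = ereal m" "\<forall>j\<le>N. ereal m \<le> \<nu> (c j * Q ^ j)"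
    "\<forall>j\<le>N. j > J \<longrightarrow> ereal m < \<nu> (c j * Q ^ j)"
    by (rule expansion_initial[of N c i, OF assms])
  have "(\<Sum>j\<le>N. c j * Q ^ j) \<noteq> 0"
    using *(2) by (auto simp: taylor_initial_def)
  then obtain m' J' where m': "trunc \<nu> Q (\<Sum>j\<le>N. c j * Q ^ j) = ereal m'"
    "taylor_initial \<delta> (\<Sum>j\<le>N. c j * Q ^ j) m' (J' * e)"
    by (rule trunc_initial)
  have "trunc \<nu> Q (\<Sum>j\<le>N. c j * Q ^ j) = ereal m"
    unfolding m'(1) taylor_initial_unique(1)[OF m'(2) *(2)] ..
  from that[OF *(1,2) this *(3,4,5)] show thesis .
qed

lemma trunc_le_term:
  assumes "\<And>j. j \<le> N \<Longrightarrow> degree (c j) < degree Q" "i \<le> N" "c i \<noteq> 0"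
  shows "trunc \<nu> Q (\<Sum>j\<le>N. c j * Q ^ j) \<le> \<nu> (c i * Q ^ i)"
proof -
  obtain m J where "J \<le> N" "taylor_initial \<delta> (\<Sum>j\<le>N. c j * Q ^ j) m (J * e)"
    "trunc \<nu> Q (\<Sum>j\<le>N. c j * Q ^ j) = ereal m"
    "\<nu> (c J * Q ^ J) = ereal m" "\<forall>j\<le>N. ereal m \<le> \<nu> (c j * Q ^ j)"
    "\<forall>j\<le>N. j > J \<longrightarrow> ereal m < \<nu> (c j * Q ^ j)"
    by (rule trunc_expansion[of N c i, OF assms])
  then show ?thesis using assms(2) by simp
qed

text \<open>The initial forms of \<open>a\<close> and \<open>b\<close> do not involve T, hence
  neither does that of \<open>a * b\<close>. In the expansion by division with remainder the
  dominant index is therefore 0, so the remainder carries the value.\<close>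

lemma val_mult_mod:
  assumes "a \<noteq> 0" "degree a < degree Q" "b \<noteq> 0" "degree b < degree Q"
  shows "\<nu> (a * b mod Q) = \<nu> (a * b)" "\<nu> (a * b) < \<nu> ((a * b div Q) * Q)"
proof -
  define c where "c j = (if j = 0 then a * b mod Q else a * b div Q)" for j :: nat
  have ab: "(\<Sum>j\<le>1. c j * Q ^ j) = a * b"
    by (simp add: c_def)
  have ab_nz: "a * b \<noteq> 0" using assms by simp
  have "degree (a * b div Q) < degree Q"
    using degree_div_mult_le[of "a * b" Q] assms degree_Q
    by (cases "a * b div Q = 0") (auto simp: degree_mult_eq)
  moreover have "degree (a * b mod Q) < degree Q"
    using degree_mod_less[of Q "a * b"] degree_Q by auto
  ultimately have deg: "\<And>j. degree (c j) < degree Q" by (simp add: c_def)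
  obtain i where i: "i \<le> 1" "c i \<noteq> 0"
  proof -
    have "c 0 \<noteq> 0 \<or> c 1 \<noteq> 0" using ab_nz unfolding ab[symmetric] by auto
    then show thesis using that[of 0] that[of 1] by auto
  qed
  obtain m J where "J \<le> 1" and *: "taylor_initial \<delta> (a * b) m (J * e)"
    "\<nu> (c J * Q ^ J) = ereal m" and "\<forall>j\<le>1. ereal m \<le> \<nu> (c j * Q ^ j)"
    and gt: "\<forall>j\<le>1. j > J \<longrightarrow> ereal m < \<nu> (c j * Q ^ j)"
    by (rule expansion_initial[of 1 c i, OF deg i, unfolded ab])
  have "taylor_initial \<delta> (a * b) (rval a + rval b) (0 + 0)"
    using assms by (intro taylor_initial_mult initial_small)
  with *(1) have "m = rval a + rval b" "J = 0"
    using taylor_initial_unique[OF *(1), of "rval a + rval b" "0 + 0"] e_pos by auto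
  then have m: "ereal m = \<nu> (a * b)" using assms by (simp add: val_eq_rval rval_mult)
  show "\<nu> (a * b mod Q) = \<nu> (a * b)" "\<nu> (a * b) < \<nu> ((a * b div Q) * Q)"
    using *(2) gt[rule_format, of 1] m \<open>J = 0\<close> by (simp_all add: c_def)
qed

lemma key_eps_le_of_trunc_eq:
  assumes "f \<noteq> 0" "trunc \<nu> Q f = \<nu> f"
  shows "key_eps \<nu> f \<le> ereal \<delta>"
proof -
  obtain m J where "trunc \<nu> Q f = ereal m" "taylor_initial \<delta> f m (J * e)"
    by (rule trunc_initial[OF assms(1)])
  with assms show ?thesis
    by (simp add: key_eps_le_iff taylor_initial_iff val_eq_rval)
qed

text \<open>Otherwise all shifted values would be at least \<open>\<nu> f\<close>, but the one at
  index \<open>J * e\<close> is the smaller truncated value.\<close>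

lemma key_eps_gt_of_trunc_less:
  assumes "f \<noteq> 0" "trunc \<nu> Q f < \<nu> f"
  shows "ereal \<delta> < key_eps \<nu> f"
proof (rule ccontr)
  assume "\<not> ?thesis"
  then have le: "\<forall>b. ereal (rval f - real b * \<delta>) \<le> \<nu> (hasse_deriv b f)"
    using assms by (simp add: key_eps_le_iff[symmetric])
  obtain m J where "trunc \<nu> Q f = ereal m" "taylor_initial \<delta> f m (J * e)"
    by (rule trunc_initial[OF assms(1)])
  with le[rule_format, of "J * e"] assms show False
    by (simp add: taylor_initial_iff val_eq_rval)
qed

section \<open>Passage from a key polynomial to the next one\<close>

lemma degree_expansion_lt:
  assumes "\<And>j. degree (c j) < degree Q" "s \<ge> 1"
  shows "degree (\<Sum>j<s. c j * Q ^ j) < s * degree Q"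
proof (rule degree_sum_less)
  fix j assume "j \<in> {..<s}"
  then have "Suc j * degree Q \<le> s * degree Q" by (intro mult_le_mono) auto
  moreover have "degree (c j * Q ^ j) < Suc j * degree Q"
    using assms(1)[of j] degree_Q by (cases "c j = 0") (auto simp: degree_mult_eq degree_power_eq)
  ultimately show "degree (c j * Q ^ j) < s * degree Q" by linarith
qed (use assms degree_Q in auto)

text \<open>
  If the leading coefficient \<open>g\<close> is not constant, multiply \<open>F\<close> by \<open>Q div g\<close> and reduce all
  coefficients modulo \<open>Q\<close>. By \<open>val_mult_mod\<close> the truncated value stays below the value, but the
  leading coefficient gets a smaller degree, which contradicts the minimality of \<open>degree F\<close>.
\<close>

lemma lead_exp_coeff_next:
  assumes F: "lead_coeff F = 1" "degree F = next_deg \<nu> Q" "trunc \<nu> Q F < \<nu> F"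
  obtains c s where "s \<ge> 1" "\<And>j. degree (c j) < degree Q" "c s = 1"
    "F = (\<Sum>j\<le>s. c j * Q ^ j)"
proof -
  define N where "N = degree F"
  define c where "c = exp_coeff Q F"
  have F0: "F \<noteq> 0" using F by auto
  have deg_c: "degree (c j) < degree Q" for j
    unfolding c_def by (rule degree_exp_coeff[OF degree_Q])
  have FN: "F = (\<Sum>j\<le>N. c j * Q ^ j)"
    unfolding N_def c_def by (rule exp_coeff_expansion[OF degree_Q])
  define s where "s = Max {j. j \<le> N \<and> c j \<noteq> 0}"
  have ne: "{j. j \<le> N \<and> c j \<noteq> 0} \<noteq> {}"
  proof
    assume "{j. j \<le> N \<and> c j \<noteq> 0} = {}"
    then have "(\<Sum>j\<le>N. c j * Q ^ j) = 0" by (intro sum.neutral) auto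
    with FN F0 show False by simp
  qed
  then have "s \<in> {j. j \<le> N \<and> c j \<noteq> 0}" unfolding s_def by (intro Max_in) auto
  then have s: "s \<le> N" "c s \<noteq> 0" by auto
  have s_max: "c j = 0" if "j \<le> N" "j > s" for j
    using that Max_ge[of "{j. j \<le> N \<and> c j \<noteq> 0}" j] unfolding s_def by fastforce
  have Fs: "F = (\<Sum>j\<le>s. c j * Q ^ j)"
    unfolding FN using s s_max by (intro sum.mono_neutral_right) auto
  define R where "R = (\<Sum>j<s. c j * Q ^ j)"
  have FR: "F = R + c s * Q ^ s"
    unfolding Fs R_def by (simp flip: lessThan_Suc_atMost)
  have deg_lead: "degree (c s * Q ^ s) = degree (c s) + s * degree Q"
    using s by (simp add: degree_mult_eq degree_power_eq)
  have "R = 0 \<or> degree R < degree (c s * Q ^ s)"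
    using degree_expansion_lt[of c s] deg_c unfolding deg_lead R_def by (cases s) auto
  then have "degree F = degree (c s * Q ^ s)" "lead_coeff F = lead_coeff (c s * Q ^ s)"
    unfolding FR by (auto simp: degree_add_eq_right coeff_eq_0)
  moreover have "lead_coeff (c s * Q ^ s) = lead_coeff (c s)"
    unfolding lead_coeff_mult lead_coeff_power monic_Q by simp
  ultimately have deg_F: "degree F = degree (c s) + s * degree Q" and lead: "lead_coeff (c s) = 1"
    using deg_lead F(1) by metis+
  have "degree (c s) = 0"
  proof (rule ccontr)
    assume g: "degree (c s) \<noteq> 0"
    \<comment> \<open>With this choice \<open>h * c s\<close> is \<open>Q\<close> up to a remainder
      of degree below \<open>degree (c s)\<close>. Since \<open>c s\<close> is not constant,
      \<open>degree h < degree Q\<close>, as \<open>val_mult_mod\<close> requires.\<close>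
    define h where "h = Q div c s"
    have "h \<noteq> 0"
    proof
      assume "h = 0"
      then have "Q mod c s = Q" unfolding h_def by (metis add_0 div_mult_mod_eq mult_zero_left)
      then show False using degree_mod_less[OF s(2), of Q] deg_c[of s] by simp
    qed
    have hQ: "h * c s = Q - Q mod c s" by (simp add: h_def minus_mod_eq_div_mult)
    have "degree h + degree (c s) \<le> degree Q"
      using degree_div_mult_le[of Q "c s"] \<open>h \<noteq> 0\<close> s by (simp add: h_def degree_mult_eq)
    with g have deg_h: "degree h < degree Q" by simp
    define r where "r j = h * c j mod Q" for j
    define q where "q j = h * c j div Q" for j
    have deg_r: "degree (r j) < degree Q" for j
      using degree_mod_less[of Q "h * c j"] degree_Q by (auto simp: r_def)
    define G where "G = (\<Sum>j\<le>s. r j * Q ^ j)"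
    have split: "h * F = G + (\<Sum>j\<le>s. q j * Q * Q ^ j)"
    proof -
      have "h * F = (\<Sum>j\<le>s. (h * c j) * Q ^ j)"
        unfolding Fs by (simp add: sum_distrib_left mult.assoc)
      also have "\<dots> = (\<Sum>j\<le>s. r j * Q ^ j + q j * Q * Q ^ j)"
        by (intro sum.cong refl) (simp add: r_def q_def flip: distrib_right)
      finally show ?thesis by (simp add: G_def sum.distrib)
    qed
    obtain J m where J: "J \<le> s" "taylor_initial \<delta> (\<Sum>j\<le>s. c j * Q ^ j) m (J * e)"
      "trunc \<nu> Q (\<Sum>j\<le>s. c j * Q ^ j) = ereal m"
      "\<nu> (c J * Q ^ J) = ereal m" "\<forall>j\<le>s. ereal m \<le> \<nu> (c j * Q ^ j)"
      "\<forall>j\<le>s. j > J \<longrightarrow> ereal m < \<nu> (c j * Q ^ j)"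
      by (rule trunc_expansion[of s c s]) (use deg_c s in auto)
    \<comment> \<open>\<open>v\<close> is the value of \<open>h\<close> times a minimal term of
      \<open>F\<close>. Reduction preserves the value of the term \<open>J\<close>, while the
      discarded multiples of \<open>Q\<close> and \<open>h * F\<close> itself have values above
      \<open>v\<close>; so \<open>v\<close> separates the truncated value of \<open>G\<close> from
      its value.\<close>
    define v where "v = ereal (rval h + m)"
    have vm: "v = \<nu> h + ereal m" using \<open>h \<noteq> 0\<close> by (simp add: v_def val_eq_rval)
    have "c J \<noteq> 0" using J(4) by auto
    then have "\<nu> (r J * Q ^ J) = v"
      using val_mult_mod(1)[OF \<open>h \<noteq> 0\<close> deg_h \<open>c J \<noteq> 0\<close> deg_c] J(4)
      by (simp add: r_def val_mult vm flip: add.assoc) (simp add: add.assoc)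
    moreover from this have "r J \<noteq> 0" by (auto simp: v_def)
    ultimately have "trunc \<nu> Q G \<le> v"
      unfolding G_def using trunc_le_term[of s r J] deg_r J(1) by auto
    also have "v < \<nu> G"
    proof -
      have "v < \<nu> (\<Sum>j\<le>s. q j * Q * Q ^ j)"
      proof (rule val_sum_gt)
        fix j assume j: "j \<in> {..s}"
        show "v < \<nu> (q j * Q * Q ^ j)"
        proof (cases "c j = 0")
          case False
          have "v \<le> \<nu> h + \<nu> (c j * Q ^ j)"
            unfolding vm using J(5) j by (intro add_left_mono) auto
          also have "\<dots> = \<nu> (h * c j) + \<nu> (Q ^ j)" by (simp add: val_mult add.assoc)
          also have "\<dots> < \<nu> (q j * Q) + \<nu> (Q ^ j)"
            using val_mult_mod(2)[OF \<open>h \<noteq> 0\<close> deg_h False deg_c]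
            by (cases "\<nu> (q j * Q)"; cases "\<nu> (h * c j)") (auto simp: q_def val_eq_rval)
          finally show ?thesis by (simp add: val_mult)
        qed (simp add: q_def v_def)
      qed (simp add: v_def)
      moreover have "v < \<nu> (h * F)"
        using F(3) J(3) \<open>h \<noteq> 0\<close> F0 unfolding Fs[symmetric]
        by (simp add: v_def val_mult val_eq_rval)
      ultimately show ?thesis
        using val_diff[of "h * F" "\<Sum>j\<le>s. q j * Q * Q ^ j"] split
        by (auto simp: min_def split: if_splits)
    qed
    finally have "degree F \<le> degree G" using next_deg_le F(2) by simp
    moreover have "degree G < degree F"
    proof -
      \<comment> \<open>Modulo \<open>Q\<close> the product \<open>h * c s\<close> reduces to the
        negative of a remainder of division by \<open>c s\<close>; this is the drop in
        degree.\<close>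
      have "r s = - (Q mod c s) \<or> r s = 0"
      proof -
        have "r s = (Q - Q mod c s) mod Q" unfolding r_def hQ ..
        also have "\<dots> = - (Q mod c s) mod Q"
          using mod_add_self1[of Q "- (Q mod c s)"] by simp
        also have "\<dots> = - (Q mod c s)"
          using degree_mod_less[OF s(2), of Q] deg_c[of s] degree_Q by (intro mod_poly_less) auto
        finally show ?thesis ..
      qed
      then have "degree (r s) < degree (c s)"
        using degree_mod_less[OF s(2), of Q] g by auto
      then have "degree (r s * Q ^ s) < degree F"
        unfolding deg_F by (cases "r s = 0") (use g in \<open>auto simp: degree_mult_eq degree_power_eq\<close>)
      moreover have "degree (\<Sum>j<s. r j * Q ^ j) < degree F"
        using degree_expansion_lt[of r s] deg_r g unfolding deg_F by (cases s) fastforce+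
      ultimately show ?thesis
        unfolding G_def by (simp flip: lessThan_Suc_atMost add: degree_add_less)
    qed
    ultimately show False by simp
  qed
  with lead have "c s = 1"
    by (auto elim!: degree_eq_zeroE simp: one_pCons)
  moreover have "s \<ge> 1"
    using degree_ge_of_trunc_less[OF F(3)] degree_Q deg_F \<open>degree (c s) = 0\<close> by (cases s) auto
  ultimately show thesis using deg_c Fs that by blast
qed

text \<open>If \<open>\<nu> F\<close> were below the value of the leading term \<open>Q ^ s\<close>,
  dropping that term would leave a polynomial of smaller degree whose truncated value is still below
  its value, against the minimality of \<open>degree F\<close>.\<close>

lemma val_next_ge:
  assumes F: "lead_coeff F = 1" "degree F = next_deg \<nu> Q" "trunc \<nu> Q F < \<nu> F"
    and "0 \<le> \<nu> Q"
  shows "\<nu> Q \<le> \<nu> F"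
proof -
  obtain c s where s: "s \<ge> 1" and deg_c: "\<And>j. degree (c j) < degree Q" and "c s = 1"
    and Fs: "F = (\<Sum>j\<le>s. c j * Q ^ j)"
    using lead_exp_coeff_next[OF F] by metis
  have "\<nu> (Q ^ s) \<le> \<nu> F"
  proof (rule ccontr)
    assume "\<not> ?thesis"
    then have less: "\<nu> F < \<nu> (Q ^ s)" by simp
    define R where "R = (\<Sum>j<s. c j * Q ^ j)"
    have FR: "F = R + Q ^ s"
      unfolding Fs R_def using \<open>c s = 1\<close> by (simp flip: lessThan_Suc_atMost)
    have deg_R: "degree R < s * degree Q"
      unfolding R_def by (rule degree_expansion_lt[OF deg_c s])
    then have "degree F = s * degree Q"
      unfolding FR by (subst degree_add_eq_right) (simp_all add: degree_power_eq)
    obtain J m where J: "J \<le> s" "taylor_initial \<delta> (\<Sum>j\<le>s. c j * Q ^ j) m (J * e)"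
      "trunc \<nu> Q (\<Sum>j\<le>s. c j * Q ^ j) = ereal m"
      "\<nu> (c J * Q ^ J) = ereal m" "\<forall>j\<le>s. ereal m \<le> \<nu> (c j * Q ^ j)"
      "\<forall>j\<le>s. j > J \<longrightarrow> ereal m < \<nu> (c j * Q ^ j)"
      by (rule trunc_expansion[of s c s]) (use deg_c \<open>c s = 1\<close> in auto)
    have m: "ereal m < \<nu> F" using J(3) F(3) unfolding Fs[symmetric] by simp
    \<comment> \<open>The minimal term has value below \<open>\<nu> F\<close>, hence it is not
      \<open>Q ^ s\<close> and survives in \<open>R\<close>.\<close>
    then have "J \<noteq> s" using J(4) less \<open>c s = 1\<close> by auto
    then have "J \<le> s - 1" using J(1) by simp
    have R: "R = (\<Sum>j\<le>s - 1. c j * Q ^ j)"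
      unfolding R_def using s by (intro sum.cong) auto
    have "trunc \<nu> Q R \<le> \<nu> (c J * Q ^ J)"
      unfolding R using deg_c \<open>J \<le> s - 1\<close> J(4) by (intro trunc_le_term) auto
    also have "\<dots> < \<nu> R"
      using val_diff[of F "Q ^ s"] m less J(4) unfolding FR by (auto simp: min_def split: if_splits)
    finally have "degree F \<le> degree R" using next_deg_le F(2) by simp
    with deg_R \<open>degree F = s * degree Q\<close> show False by simp
  qed
  moreover have "\<nu> Q \<le> \<nu> (Q ^ s)"
    using s assms(4) by (simp add: val_power val_eq_rval mult_le_cancel_right1)
  ultimately show ?thesis by (rule order_trans[rotated])
qed

text \<open>The number \<open>\<delta>\<close> separates \<open>key_eps \<nu> F\<close> from the
  values of \<open>key_eps \<nu>\<close> at nonzero polynomials of smaller degree; the bound by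
  \<open>\<nu> yvar\<close> comes from \<open>val_next_ge\<close>.\<close>

lemma key_poly_next:
  assumes F: "lead_coeff F = 1" "degree F = next_deg \<nu> Q" "trunc \<nu> Q F < \<nu> F"
    and y: "\<nu> yvar \<le> \<nu> Q"
  shows "key_poly \<nu> F"
  unfolding key_poly_def
proof (intro conjI allI impI)
  have "0 \<le> \<nu> Q" using order_trans[OF _ order_trans[OF val_y y]] by simp
  then show "\<nu> yvar \<le> \<nu> F" using val_next_ge[OF F] y by simp
  fix f assume f: "f \<noteq> 0 \<and> key_eps \<nu> F \<le> key_eps \<nu> f"
  show "degree F \<le> degree f"
  proof (rule ccontr)
    assume "\<not> degree F \<le> degree f"
    then have "trunc \<nu> Q f = \<nu> f"
      using trunc_eq_below_next_deg[OF degree_Q] F(2) by simp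
    then have "key_eps \<nu> f \<le> ereal \<delta>" using f key_eps_le_of_trunc_eq by simp
    moreover have "ereal \<delta> < key_eps \<nu> F"
      using F by (intro key_eps_gt_of_trunc_less) auto
    ultimately have "key_eps \<nu> f < key_eps \<nu> F" by (rule le_less_trans)
    with f show False by (meson leD)
  qed
qed (fact F)

end

context finite_valuation_x
begin

text \<open>With \<open>\<delta>\<close> equal to \<open>key_eps \<nu> Q\<close>, the contrapositive
  of the degree condition bounds \<open>key_eps\<close> strictly below \<open>\<delta>\<close> in
  smaller degrees, so those initial forms do not involve T.\<close>

lemma key_polynomial_of_key_poly:
  assumes "key_poly \<nu> Q" "degree Q \<ge> 1"
  obtains \<delta> e where "key_polynomial \<nu> Q \<delta> e"
proof -
  obtain \<delta> e where *: "key_eps \<nu> Q = ereal \<delta>" "e \<ge> 1" "taylor_initial \<delta> Q (rval Q) e"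
    using taylor_initial_key_eps[OF assms(2)] by metis
  have "taylor_initial \<delta> c (rval c) 0" if "c \<noteq> 0" "degree c < degree Q" for c
    using that assms(1) *(1) by (intro taylor_initial_of_key_eps_less) (auto simp: key_poly_def not_le[symmetric])
  with * assms have "key_polynomial \<nu> Q \<delta> e"
    by unfold_locales (auto simp: key_poly_def)
  then show thesis by (rule that)
qed

text \<open>All higher derivatives of a constant vanish, so its \<open>key_eps\<close> is
  \<open>-\<infinity>\<close>, whereas that of \<open>yvar\<close> is real.\<close>

lemma key_poly_y: "key_poly \<nu> yvar"
proof -
  have "degree f \<ge> 1" if f: "f \<noteq> 0" "key_eps \<nu> yvar \<le> key_eps \<nu> f" for f
  proof (rule ccontr)
    assume "\<not> ?thesis"
    then have "degree f = 0" by simp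
    then have "eps_term f b = -\<infinity>" if "b \<ge> 1" for b
      using that by (simp add: eps_term_def hasse_deriv_eq_0)
    then have "key_eps \<nu> f \<le> -\<infinity>"
      unfolding key_eps_eq by (intro SUP_least) auto
    moreover obtain \<delta> where "key_eps \<nu> yvar = ereal \<delta>"
      using taylor_initial_key_eps[of yvar] by auto
    ultimately show False using f by simp
  qed
  then show ?thesis by (simp add: key_poly_def)
qed

end

subsection \<open>Generation by products\<close>

lemma group_closure_mono: "S \<subseteq> T \<Longrightarrow> group_closure S \<subseteq> group_closure T"
proof
  fix f assume "S \<subseteq> T" "f \<in> group_closure S"
  from this(2,1) show "f \<in> group_closure T"
    by (induction rule: group_closure.induct) (auto intro: group_closure.intros)
qed

lemma group_closure_sum:
  "(\<And>x. x \<in> A \<Longrightarrow> f x \<in> group_closure S) \<Longrightarrow> sum f A \<in> group_closure S"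
  by (induction A rule: infinite_finite_induct) (auto intro: group_closure_add)

context valuation_x
begin

lemma key_products_antimono: "\<beta> \<le> \<beta>' \<Longrightarrow> key_products \<nu> I Q \<beta>' \<subseteq> key_products \<nu> I Q \<beta>"
  unfolding key_products_def by (blast intro: order_trans)

lemma val_key_products: "f \<in> key_products \<nu> I Q \<beta> \<Longrightarrow> \<beta> \<le> \<nu> f"
proof -
  assume "f \<in> key_products \<nu> I Q \<beta>"
  then obtain a and s :: nat and i \<gamma>
    where "f = [:a:] * (\<Prod>j = 1..s. Q (i j) ^ \<gamma> j)"
      "\<beta> \<le> \<nu> [:a:] + (\<Sum>j = 1..s. ereal (real (\<gamma> j)) * \<nu> (Q (i j)))"
    unfolding key_products_def by blast
  then show ?thesis by (simp only: val_mult val_prod val_power)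
qed

lemma val_group_closure: "f \<in> group_closure (key_products \<nu> I Q \<beta>) \<Longrightarrow> \<beta> \<le> \<nu> f"
proof (induction rule: group_closure.induct)
  case (diff f g)
  then have "\<beta> \<le> min (\<nu> f) (\<nu> g)" by simp
  also have "\<dots> \<le> \<nu> (f - g)" by (rule val_diff)
  finally show ?case .
qed (auto simp: val_key_products)

lemma key_products_mult_power:
  assumes "f \<in> key_products \<nu> I Q \<beta>" "n \<in> I"
  shows "f * Q n ^ k \<in> key_products \<nu> I Q (\<beta> + \<nu> (Q n ^ k))"
proof -
  obtain a and s :: nat and i \<gamma>
    where f: "f = [:a:] * (\<Prod>j = 1..s. Q (i j) ^ \<gamma> j)" "\<forall>j\<in>{1..s}. i j \<in> I"
      "\<beta> \<le> \<nu> [:a:] + (\<Sum>j = 1..s. ereal (real (\<gamma> j)) * \<nu> (Q (i j)))"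
    using assms(1) unfolding key_products_def by blast
  \<comment> \<open>The power of \<open>Q n\<close> is appended as factor number
    \<open>Suc s\<close>; indices may repeat, so \<open>n\<close> may already occur.\<close>
  define i' where "i' = i(Suc s := n)"
  define \<gamma>' where "\<gamma>' = \<gamma>(Suc s := k)"
  have "(\<Prod>j = 1..Suc s. Q (i' j) ^ \<gamma>' j) = (\<Prod>j = 1..s. Q (i' j) ^ \<gamma>' j) * Q n ^ k"
    by (simp add: i'_def \<gamma>'_def)
  also have "(\<Prod>j = 1..s. Q (i' j) ^ \<gamma>' j) = (\<Prod>j = 1..s. Q (i j) ^ \<gamma> j)"
    by (intro prod.cong) (auto simp: i'_def \<gamma>'_def)
  finally have prod: "f * Q n ^ k = [:a:] * (\<Prod>j = 1..Suc s. Q (i' j) ^ \<gamma>' j)"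
    unfolding f(1) by (simp add: mult.assoc)
  have "(\<Sum>j = 1..Suc s. ereal (real (\<gamma>' j)) * \<nu> (Q (i' j)))
      = (\<Sum>j = 1..s. ereal (real (\<gamma>' j)) * \<nu> (Q (i' j))) + \<nu> (Q n ^ k)"
    by (simp add: i'_def \<gamma>'_def val_power)
  also have "(\<Sum>j = 1..s. ereal (real (\<gamma>' j)) * \<nu> (Q (i' j)))
      = (\<Sum>j = 1..s. ereal (real (\<gamma> j)) * \<nu> (Q (i j)))"
    by (intro sum.cong) (auto simp: i'_def \<gamma>'_def)
  finally have "\<beta> + \<nu> (Q n ^ k) \<le> \<nu> [:a:] + (\<Sum>j = 1..Suc s. ereal (real (\<gamma>' j)) * \<nu> (Q (i' j)))"
    using add_right_mono[OF f(3), of "\<nu> (Q n ^ k)"] by (simp only: add.assoc)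
  moreover have "\<forall>j\<in>{1..Suc s}. i' j \<in> I"
    using f(2) assms(2) by (auto simp: i'_def)
  ultimately show ?thesis
    unfolding key_products_def using prod by blast
qed

lemma group_closure_mult_power:
  assumes "n \<in> I"
  shows "f \<in> group_closure (key_products \<nu> I Q \<beta>) \<Longrightarrow>
    f * Q n ^ k \<in> group_closure (key_products \<nu> I Q (\<beta> + \<nu> (Q n ^ k)))"
proof (induction rule: group_closure.induct)
  case (base f)
  then show ?case
    using key_products_mult_power[OF _ assms] by (auto intro: group_closure.base)
next
  case (diff f g)
  then show ?case by (auto simp: left_diff_distrib intro: group_closure.diff)
qed

end

subsection \<open>The sequence of key polynomials\<close>

locale key_sequence = valuation_x +
  fixes Q :: "nat \<Rightarrow> 'a Ky"
  assumes Q_1: "Q 1 = yvar"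
    and trunc_neq: "\<And>n. n \<ge> 1 \<Longrightarrow> trunc \<nu> (Q n) \<noteq> \<nu>"
    and Q_Suc: "\<And>n. n \<ge> 1 \<Longrightarrow> Q (Suc n) \<in> Phi \<nu> (Q n)"
    and finite_Psi: "\<And>n. n \<ge> 1 \<Longrightarrow> finite (Psi \<nu> (Q n))"
begin

lemma monic: "n \<ge> 1 \<Longrightarrow> lead_coeff (Q n) = 1"
proof (induction n rule: nat_induct_at_least)
  case base
  show ?case unfolding Q_1 by simp
next
  case (Suc n)
  then show ?case using Q_Suc unfolding Phi_def by blast
qed

lemma degree_Suc: "n \<ge> 1 \<Longrightarrow> degree (Q (Suc n)) = next_deg \<nu> (Q n)"
  and trunc_less_Suc: "n \<ge> 1 \<Longrightarrow> trunc \<nu> (Q n) (Q (Suc n)) < \<nu> (Q (Suc n))"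
  using Q_Suc[of n] by (auto simp: Phi_def)

lemma degree_mono_Suc: "n \<ge> 1 \<Longrightarrow> degree (Q n) \<le> degree (Q (Suc n))"
  by (rule degree_ge_of_trunc_less[OF trunc_less_Suc])

lemma degree_mono:
  assumes "1 \<le> m" "m \<le> n"
  shows "degree (Q m) \<le> degree (Q n)"
  using assms(2)
proof (induction n rule: dec_induct)
  case (step n)
  then show ?case using degree_mono_Suc[of n] assms(1) by simp
qed simp

lemma degree_pos: "n \<ge> 1 \<Longrightarrow> degree (Q n) \<ge> 1"
  using degree_mono[of 1 n] Q_1 by simp

lemma val_Q_finite: "n \<ge> 1 \<Longrightarrow> \<nu> (Q n) \<noteq> \<infinity>"
  using trunc_eq_of_val_infty[OF degree_pos] trunc_neq by blast

lemma degree_unbounded: "\<exists>n\<ge>1. d < degree (Q n)"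
proof (rule ccontr)
  assume "\<not> ?thesis"
  then have bound: "\<And>n. n \<ge> 1 \<Longrightarrow> degree (Q n) \<le> d" by force
  define D where "D = (\<lambda>n. degree (Q n)) ` {1..}"
  have "D \<subseteq> {..d}" using bound by (auto simp: D_def)
  then have D: "finite D" by (rule finite_subset) simp
  have "Max D \<in> D" using D by (intro Max_in) (auto simp: D_def)
  \<comment> \<open>The bounded degrees reach their maximum at \<open>N\<close> and, being monotone,
    are constant from there on.\<close>
  then obtain N where N: "N \<ge> 1" "Max D = degree (Q N)" by (auto simp: D_def)
  have stable: "degree (Q n) = degree (Q N)" if "n \<ge> N" for n
  proof (rule antisym)
    have "degree (Q n) \<in> D" using that N by (auto simp: D_def)
    then show "degree (Q n) \<le> degree (Q N)" using D N(2) by (metis Max_ge)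
  qed (use degree_mono that N in simp)
  have less_Suc: "\<nu> (Q n) < \<nu> (Q (Suc n))" if "n \<ge> N" for n
    using that N stable[of n] stable[of "Suc n"] trunc_less_Suc[of n]
      trunc_less_monic_same_degree[of "Q n" "Q (Suc n)"] degree_pos[of n] monic[of n] monic[of "Suc n"]
    by simp
  have "strict_mono (\<lambda>i. \<nu> (Q (N + i)))"
    using less_Suc by (simp add: strict_mono_Suc_iff)
  note mono = strict_mono_less[OF this] strict_mono_eq[OF this]
  have less: "\<nu> (Q N) < \<nu> (Q (N + Suc i))" for i
    using mono(1)[of 0 "Suc i"] by simp
  have inj: "inj (\<lambda>i. \<nu> (Q (N + Suc i)))"
    using mono(2)[of "Suc _" "Suc _"] by (simp add: inj_def)
  \<comment> \<open>Every later member, not only \<open>Q (Suc N)\<close>, has degree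
    \<open>next_deg \<nu> (Q N)\<close> and value above \<open>\<nu> (Q N)\<close>, so it lies in
    \<open>Phi \<nu> (Q N)\<close>. The shift by \<open>Suc i\<close> leaves out \<open>Q N\<close>
    itself.\<close>
  have "\<nu> (Q (N + Suc i)) \<in> Psi \<nu> (Q N)" for i
    using N less[of i] stable[of "N + Suc i"] stable[of "Suc N"] degree_Suc[of N]
      trunc_less_monic_same_degree[of "Q N" "Q (N + Suc i)"] degree_pos[of N] monic[of N]
      monic[of "N + Suc i"]
    unfolding Psi_def Phi_def by (intro imageI) simp
  then have "range (\<lambda>i. \<nu> (Q (N + Suc i))) \<subseteq> Psi \<nu> (Q N)" by blast
  then have "finite (range (\<lambda>i. \<nu> (Q (N + Suc i))))"
    using finite_Psi[OF N(1)] by (rule finite_subset)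
  with inj show False by (simp add: finite_image_iff)
qed

lemma trunc_eq: "n \<ge> 1 \<Longrightarrow> degree f < degree (Q (Suc n)) \<Longrightarrow> trunc \<nu> (Q n) f = \<nu> f"
  using trunc_eq_below_next_deg[OF degree_pos] by (simp add: degree_Suc)

text \<open>Below the next degree \<open>\<nu> f\<close> is a truncated value, hence at most the
  value of a nonzero term of the expansion. That value is finite by induction for the coefficient
  and by \<open>val_Q_finite\<close> for the power.\<close>

lemma val_finite_below:
  "n \<ge> 1 \<Longrightarrow> degree f < degree (Q n) \<Longrightarrow> f \<noteq> 0 \<Longrightarrow> \<nu> f \<noteq> \<infinity>"
proof (induction n arbitrary: f rule: nat_induct_at_least)
  case base
  then show ?case
    using val_const_finite by (auto simp: Q_1[simplified] elim!: degree_eq_zeroE)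
next
  case (Suc n)
  note deg_Q = degree_pos[OF Suc.hyps(1)]
  let ?c = "exp_coeff (Q n) f"
  obtain j where j: "j \<le> degree f" "?c j \<noteq> 0"
  proof (rule ccontr)
    assume "\<not> thesis"
    with that have "(\<Sum>j\<le>degree f. ?c j * Q n ^ j) = 0" by (intro sum.neutral) auto
    then have "f = 0" unfolding exp_coeff_expansion[OF deg_Q, of f, symmetric] .
    with Suc.prems show False by simp
  qed
  have "\<nu> f \<le> \<nu> (?c j * Q n ^ j)"
    using j unfolding trunc_eq[OF Suc.hyps(1) Suc.prems(1), symmetric] trunc_def by (intro Min_le) auto
  moreover have "\<nu> (?c j * Q n ^ j) \<noteq> \<infinity>"
    using Suc.IH[OF degree_exp_coeff[OF deg_Q] j(2)] val_Q_finite[OF Suc.hyps(1)]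
    by (cases "\<nu> (Q n)") (auto simp: val_mult val_power)
  ultimately show ?case by auto
qed

lemma finite_valuation: "finite_valuation_x \<nu>"
proof
  fix f :: "'a Ky" assume "f \<noteq> 0"
  with degree_unbounded[of "degree f"] val_finite_below show "\<nu> f \<noteq> \<infinity>" by blast
qed

lemma key_poly_Q: "n \<ge> 1 \<Longrightarrow> key_poly \<nu> (Q n)"
proof (induction n rule: nat_induct_at_least)
  case base
  show ?case unfolding Q_1 by (rule finite_valuation_x.key_poly_y[OF finite_valuation])
next
  case (Suc n)
  obtain \<delta> e where "key_polynomial \<nu> (Q n) \<delta> e"
    using finite_valuation_x.key_polynomial_of_key_poly[OF finite_valuation Suc.IH degree_pos]
      Suc.hyps by metis
  then interpret key_polynomial \<nu> "Q n" \<delta> e .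
  show ?case
    using Suc monic[of "Suc n"] degree_Suc[of n] trunc_less_Suc[of n]
    by (intro key_poly_next) (auto simp: key_poly_def)
qed

text \<open>Since \<open>\<nu> f\<close> is a truncated value, each term of the expansion has value
  at least \<open>\<nu> f\<close>. Its coefficient is generated by induction, and multiplying by a
  power of \<open>Q n\<close> stays within products.\<close>

lemma generated_below:
  "n \<ge> 1 \<Longrightarrow> degree f < degree (Q n) \<Longrightarrow> f \<in> group_closure (key_products \<nu> {1..} Q (\<nu> f))"
proof (induction n arbitrary: f rule: nat_induct_at_least)
  case base
  then obtain a where "f = [:a:]"
    by (auto simp: Q_1[simplified] elim!: degree_eq_zeroE)
  then have "f \<in> key_products \<nu> {1..} Q (\<nu> f)"
    unfolding key_products_def
    \<comment> \<open>A constant is an empty product: for \<open>s = 0\<close> the index function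
      \<open>id\<close> is a dummy.\<close>
    by (intro CollectI exI[of _ a] exI[of _ "0 :: nat"] exI[of _ id]) simp
  then show ?case by (simp add: group_closure.base)
next
  case (Suc n)
  note deg_Q = degree_pos[OF Suc.hyps(1)]
  let ?c = "exp_coeff (Q n) f"
  have "?c j * Q n ^ j \<in> group_closure (key_products \<nu> {1..} Q (\<nu> f))" if "j \<le> degree f" for j
  proof -
    have "?c j * Q n ^ j \<in> group_closure (key_products \<nu> {1..} Q (\<nu> (?c j) + \<nu> (Q n ^ j)))"
      using Suc.hyps by (intro group_closure_mult_power Suc.IH degree_exp_coeff deg_Q) simp
    moreover have "\<nu> f \<le> \<nu> (?c j) + \<nu> (Q n ^ j)"
      using that unfolding trunc_eq[OF Suc.hyps(1) Suc.prems(1), symmetric] trunc_def val_mult[symmetric]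
      by (intro Min_le) auto
    ultimately show ?thesis
      using group_closure_mono[OF key_products_antimono] by blast
  qed
  then have "(\<Sum>j\<le>degree f. ?c j * Q n ^ j) \<in> group_closure (key_products \<nu> {1..} Q (\<nu> f))"
    by (intro group_closure_sum) auto
  then show ?case unfolding exp_coeff_expansion[OF deg_Q, of f, symmetric] .
qed

lemma complete: "complete_key_polys \<nu> {1..} Q"
  unfolding complete_key_polys_def
proof (intro conjI ballI)
  fix \<beta>
  show "{f. \<beta> \<le> \<nu> f} = group_closure (key_products \<nu> {1..} Q \<beta>)"
  proof (intro antisym subsetI)
    fix f assume "f \<in> {f. \<beta> \<le> \<nu> f}"
    then have "key_products \<nu> {1..} Q (\<nu> f) \<subseteq> key_products \<nu> {1..} Q \<beta>"
      by (intro key_products_antimono) simp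
    moreover obtain n where "n \<ge> 1" "degree f < degree (Q n)"
      using degree_unbounded by blast
    ultimately show "f \<in> group_closure (key_products \<nu> {1..} Q \<beta>)"
      using generated_below group_closure_mono by blast
  qed (simp add: val_group_closure)
qed (simp add: key_poly_Q)

end

theorem theorem4p21:
  fixes \<nu> :: "'k::field Ky \<Rightarrow> ereal"
    and I :: "nat set"
    and Q :: "nat \<Rightarrow> 'k Ky"
  assumes "\<nu> \<in> val_x"
    and "construction \<nu> I Q"
    and "I = {1..}"
    and "\<forall>i\<in>I. finite (Psi \<nu> (Q i))"
  shows "complete_key_polys \<nu> I Q"
proof -
  have step: "trunc \<nu> (Q n) \<noteq> \<nu>" "Q (Suc n) \<in> Phi \<nu> (Q n)" if "n \<ge> 1" for n
    using that assms(2,3) by (auto simp: construction_def)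
  interpret key_sequence \<nu> Q
    by unfold_locales (use assms step in \<open>auto simp: construction_def\<close>)
  show ?thesis unfolding assms(3) by (rule complete)
qed

end
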